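(* Let $\ell\in\frac12\mathbb{N}$. For $\mathrm{End}(H^\ell)$-valued functions $\Phi,\Psi$ on $A_*$ define $$\langle\Phi,\Psi\rangle=\frac{2}{\pi}\int_{A_*}\Phi(a)\,(\Psi(a))^*\,|D_*(a)|\,da,\qquad D_*(a_t)=\sin^2 t .$$ This pairing is a matrix-valued inner product, and the full spherical functions $\Phi^\ell_d$ with $d\in\mathbb{N}$ form an orthogonal family with respect to this inner product.
   Context: A matrix-valued inner product is a pairing with values in matrices that is linear in the first variable, satisfies $\langle S\Phi,\Psi\rangle=S\langle\Phi,\Psi\rangle$ for constant matrices $S$ and $\langle\Phi,\Psi\rangle^*=\langle\Psi,\Phi\rangle$, and is such that $\langle\Phi,\Phi\rangle\ge0$, with $\langle\Phi,\Phi\rangle=0$ only if $\Phi=0$. Orthogonal family means $\langle\Phi^\ell_d,\Phi^\ell_{d'}\rangle=0$ for $d\ne d'$. $\mathbb{N}=\{0,1,2,\dots\}$. $K=\mathrm{SU}(2)$, $U=K\times K$. $m_t=\mathrm{diag}(e^{it/2},e^{-it/2})$, $a_t=(m_t,m_{-t})\in U$, $A_*=\{a_t:0\le t<4\pi\}$, and $da$ is the invariant (Haar) measure on the circle group $A_*$. For $\ell\in\frac12\mathbb{N}$, $H^\ell=\mathbb{C}[x,y]_{2\ell}$ is the space of homogeneous polynomials of degree $2\ell$, with $K$ acting by $T^\ell(k)p=p\circ k^t$ ($k^t$ the transpose), and orthonormal basis $\psi^\ell_j=\binom{2\ell}{\ell-j}^{1/2}x^{\ell-j}y^{\ell+j}$,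 $j=-\ell,\dots,\ell$; $\mathrm{End}(H^\ell)$ is identified with matrices indexed by $\{-\ell,\dots,\ell\}$ in this basis. For $(\ell_1,\ell_2)\in\frac12\mathbb{N}\times\frac12\mathbb{N}$ with $|\ell_1-\ell_2|\le\ell\le\ell_1+\ell_2$, $\ell_1+\ell_2-\ell\in\mathbb{Z}$, let $\beta^{\ell_1,\ell_2}_\ell:H^\ell\to H^{\ell_1}\otimes H^{\ell_2}$ be the $K$-intertwiner $\psi^\ell_j\mapsto\sum_{j_1,j_2}C^{\ell_1,\ell_2,\ell}_{j_1,j_2,j}\psi^{\ell_1}_{j_1}\otimes\psi^{\ell_2}_{j_2}$ ($C$ = standard Clebsch-Gordan coefficients) and $\Phi^\ell_{\ell_1,\ell_2}(x)=(\beta^{\ell_1,\ell_2}_\ell)^*\circ T^{\ell_1,\ell_2}(x)\circ\beta^{\ell_1,\ell_2}_\ell$ for $x\in U$, where $T^{\ell_1,\ell_2}$ is the outer tensor product representation of $U$. On $A_*$ these are diagonal: $(\Phi^\ell_{\ell_1,\ell_2}(a_t))_{j,j}=\sum_{j_1,j_2}e^{i(j_2-j_1)t}(C^{\ell_1,\ell_2,\ell}_{j_1,j_2,j})^2$. With $\zeta(d,k)=\left(\frac{d+\ell+k}{2},\frac{d+\ell-k}{2}\right)$, the full spherical function of type $\ell$ and degree $d\in\mathbb{N}$ is $\Phi^\ell_d:A_*\to\mathrm{End}(H^\ell)$, $(\Phi^\ell_d(a))_{p,q}=(\Phi^\ell_{\zeta(d,p)}(a))_{q,q}$, $p,q\in\{-\ell,\dots,\ell\}$.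 *)

theory Defs
  imports "Jordan_Normal_Form.Schur_Decomposition" "HOL-Analysis.Analysis"
begin

no_notation vec_index (infixl "$" 100)

text \<open>
  Spins are real numbers in \<open>half_nats\<close>. A basis of \<open>H\<^sup>\<ell>\<close> has \<open>dimH l = 2 l + 1\<close> elements,
  and matrix index \<open>i < dimH l\<close> stands for the weight \<open>wt l i = - l + i\<close>, so that
  \<open>wt l 0, wt l 1, \<dots>\<close> run through \<open>-l, -l + 1, \<dots>, l\<close>.
\<close>

definition half_nats :: "real set" where
  "half_nats = {real n / 2 | n. True}"

definition dimH :: "real \<Rightarrow> nat" where
  "dimH l = nat \<lfloor>2 * l\<rfloor> + 1"

definition wt :: "real \<Rightarrow> nat \<Rightarrow> real" where
  "wt l i = - l + real i"

type_synonym cmat2 = "complex ^ 2 ^ 2"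

definition m_elt :: "real \<Rightarrow> cmat2" where
  "m_elt t = vector [vector [cis (t / 2), 0], vector [0, cis (- t / 2)]]"

definition a_elt :: "real \<Rightarrow> cmat2 \<times> cmat2" where
  "a_elt t = (m_elt t, m_elt (- t))"

definition A_star :: "(cmat2 \<times> cmat2) set" where
  "A_star = a_elt ` {0..<4 * pi}"

definition mult_U :: "cmat2 \<times> cmat2 \<Rightarrow> cmat2 \<times> cmat2 \<Rightarrow> cmat2 \<times> cmat2" where
  "mult_U x y = (fst x ** fst y, snd x ** snd y)"

text \<open>
  Haar measures on \<open>A_star\<close>: nonzero finite Borel measures invariant under translation. They are
  unique up to a positive factor, which is left unspecified.
\<close>

definition haar_measure_A_star :: "(cmat2 \<times> cmat2) measure \<Rightarrow> bool" where
  "haar_measure_A_star \<mu> \<longleftrightarrow>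
     sets \<mu> = sets (restrict_space borel A_star) \<and>
     finite_measure \<mu> \<and>
     emeasure \<mu> (space \<mu>) \<noteq> 0 \<and>
     (\<forall>g\<in>A_star. distr \<mu> \<mu> (mult_U g) = \<mu>)"

definition angle :: "cmat2 \<times> cmat2 \<Rightarrow> real" where
  "angle a = (THE t. t \<in> {0..<4 * pi} \<and> a = a_elt t)"

definition D_star :: "cmat2 \<times> cmat2 \<Rightarrow> real" where
  "D_star a = (sin (angle a))\<^sup>2"

text \<open>Elements of \<open>H\<^sup>\<ell>\<close> are treated as polynomial functions of \<open>v = (x, y)\<close>.\<close>

definition psi :: "real \<Rightarrow> real \<Rightarrow> complex ^ 2 \<Rightarrow> complex" where
  "psi l j v = complex_of_real (sqrt (real (nat \<lfloor>2 * l\<rfloor> choose nat \<lfloor>l - j\<rfloor>)))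
                 * (v $ 1) ^ nat \<lfloor>l - j\<rfloor> * (v $ 2) ^ nat \<lfloor>l + j\<rfloor>"

definition act :: "cmat2 \<Rightarrow> (complex ^ 2 \<Rightarrow> complex) \<Rightarrow> complex ^ 2 \<Rightarrow> complex" where
  "act k p = (\<lambda>v. p (transpose k *v v))"

definition coords :: "real \<Rightarrow> (complex ^ 2 \<Rightarrow> complex) \<Rightarrow> complex Matrix.vec" where
  "coords l p = (THE c. c \<in> carrier_vec (dimH l) \<and>
                   p = (\<lambda>v. \<Sum>i<dimH l. vec_index c i * psi l (wt l i) v))"

definition T_rep :: "real \<Rightarrow> cmat2 \<Rightarrow> complex mat" where
  "T_rep l k = mat_of_cols (dimH l) (map (\<lambda>j. coords l (act k (psi l (wt l j)))) [0..<dimH l])"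

text \<open>
  The basis vector \<open>psi l1 (wt l1 i1) \<otimes> psi l2 (wt l2 i2)\<close> of \<open>H\<^sup>\<ell>\<^sup>1 \<otimes> H\<^sup>\<ell>\<^sup>2\<close> has number
  \<open>i1 * dimH l2 + i2\<close>.
\<close>

definition kronecker :: "complex mat \<Rightarrow> complex mat \<Rightarrow> complex mat" where
  "kronecker A B = Matrix.mat (dim_row A * dim_row B) (dim_col A * dim_col B)
     (\<lambda>(r, c). A $$ (r div dim_row B, c div dim_col B) * B $$ (r mod dim_row B, c mod dim_col B))"

definition T_outer :: "real \<Rightarrow> real \<Rightarrow> cmat2 \<times> cmat2 \<Rightarrow> complex mat" where
  "T_outer l1 l2 x = kronecker (T_rep l1 (fst x)) (T_rep l2 (snd x))"

definition rfact :: "real \<Rightarrow> real" where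
  "rfact x = fact (nat \<lfloor>x\<rfloor>)"

text \<open>
  Clebsch--Gordan coefficients in the Condon--Shortley phase convention, given by Racah's closed
  formula; the sum runs over all \<open>k\<close> for which no factorial has a negative argument. The raising
  and lowering operators of the derived representation act on the basis \<open>psi\<close> with the standard
  nonnegative matrix entries, so the standard coefficients are the right ones for this basis.
\<close>

definition CG :: "real \<Rightarrow> real \<Rightarrow> real \<Rightarrow> real \<Rightarrow> real \<Rightarrow> real \<Rightarrow> real" where
  "CG l1 l2 l j1 j2 j =
    (if j1 + j2 = j then
       sqrt ((2 * l + 1) * rfact (l + l1 - l2) * rfact (l - l1 + l2) * rfact (l1 + l2 - l)
              / rfact (l1 + l2 + l + 1))
       * sqrt (rfact (l + j) * rfact (l - j) * rfact (l1 - j1) * rfact (l1 + j1)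
                * rfact (l2 - j2) * rfact (l2 + j2))
       * (\<Sum>k | real k \<le> l1 + l2 - l \<and> real k \<le> l1 - j1 \<and> real k \<le> l2 + j2 \<and>
                0 \<le> l - l2 + j1 + real k \<and> 0 \<le> l - l1 - j2 + real k.
            (- 1) ^ k / (fact k * rfact (l1 + l2 - l - real k) * rfact (l1 - j1 - real k)
               * rfact (l2 + j2 - real k) * rfact (l - l2 + j1 + real k)
               * rfact (l - l1 - j2 + real k)))
     else 0)"

definition beta :: "real \<Rightarrow> real \<Rightarrow> real \<Rightarrow> complex mat" where
  "beta l1 l2 l = Matrix.mat (dimH l1 * dimH l2) (dimH l)
     (\<lambda>(r, j). complex_of_real
        (CG l1 l2 l (wt l1 (r div dimH l2)) (wt l2 (r mod dimH l2)) (wt l j)))"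

definition Phi :: "real \<Rightarrow> real \<Rightarrow> real \<Rightarrow> cmat2 \<times> cmat2 \<Rightarrow> complex mat" where
  "Phi l l1 l2 x = mat_adjoint (beta l1 l2 l) * T_outer l1 l2 x * beta l1 l2 l"

definition zeta :: "real \<Rightarrow> nat \<Rightarrow> real \<Rightarrow> real \<times> real" where
  "zeta l d k = ((real d + l + k) / 2, (real d + l - k) / 2)"

definition Phi_full :: "real \<Rightarrow> nat \<Rightarrow> cmat2 \<times> cmat2 \<Rightarrow> complex mat" where
  "Phi_full l d a = Matrix.mat (dimH l) (dimH l)
     (\<lambda>(p, q). (case zeta l d (wt l p) of (l1, l2) \<Rightarrow> Phi l l1 l2 a) $$ (q, q))"

text \<open>In the order on \<open>complex\<close>, \<open>0 \<le> z\<close> means that \<open>z\<close> is real and nonnegative.\<close>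

definition psd_mat :: "nat \<Rightarrow> complex mat \<Rightarrow> bool" where
  "psd_mat N M \<longleftrightarrow> M \<in> carrier_mat N N \<and> (\<forall>v\<in>carrier_vec N. (M *\<^sub>v v) \<bullet>c v \<ge> 0)"

text \<open>
  \<open>V\<close> is a space of matrix-valued functions, \<open>null\<close> says which of them count as the zero element
  (vanishing everywhere, or almost everywhere).
\<close>

definition matrix_inner_product ::
  "nat \<Rightarrow> ('x \<Rightarrow> complex mat) set \<Rightarrow> (('x \<Rightarrow> complex mat) \<Rightarrow> bool) \<Rightarrow>
   (('x \<Rightarrow> complex mat) \<Rightarrow> ('x \<Rightarrow> complex mat) \<Rightarrow> complex mat) \<Rightarrow> bool" where
  "matrix_inner_product N V null ip \<longleftrightarrow>
     (\<forall>\<Phi>\<in>V. \<forall>\<Psi>\<in>V. ip \<Phi> \<Psi> \<in> carrier_mat N N) \<and>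
     (\<forall>\<Phi>\<in>V. \<forall>\<Phi>'\<in>V. (\<lambda>x. \<Phi> x + \<Phi>' x) \<in> V \<and>
        (\<forall>\<Psi>\<in>V. ip (\<lambda>x. \<Phi> x + \<Phi>' x) \<Psi> = ip \<Phi> \<Psi> + ip \<Phi>' \<Psi>)) \<and>
     (\<forall>c. \<forall>\<Phi>\<in>V. (\<lambda>x. c \<cdot>\<^sub>m \<Phi> x) \<in> V \<and>
        (\<forall>\<Psi>\<in>V. ip (\<lambda>x. c \<cdot>\<^sub>m \<Phi> x) \<Psi> = c \<cdot>\<^sub>m ip \<Phi> \<Psi>)) \<and>
     (\<forall>S\<in>carrier_mat N N. \<forall>\<Phi>\<in>V. (\<lambda>x. S * \<Phi> x) \<in> V \<and>
        (\<forall>\<Psi>\<in>V. ip (\<lambda>x. S * \<Phi> x) \<Psi> = S * ip \<Phi> \<Psi>)) \<and>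
     (\<forall>\<Phi>\<in>V. \<forall>\<Psi>\<in>V. mat_adjoint (ip \<Phi> \<Psi>) = ip \<Psi> \<Phi>) \<and>
     (\<forall>\<Phi>\<in>V. psd_mat N (ip \<Phi> \<Phi>) \<and> (ip \<Phi> \<Phi> = 0\<^sub>m N N \<longrightarrow> null \<Phi>))"

definition orthogonal_family ::
  "nat \<Rightarrow> ('x \<Rightarrow> complex mat) set \<Rightarrow>
   (('x \<Rightarrow> complex mat) \<Rightarrow> ('x \<Rightarrow> complex mat) \<Rightarrow> complex mat) \<Rightarrow>
   (nat \<Rightarrow> 'x \<Rightarrow> complex mat) \<Rightarrow> bool" where
  "orthogonal_family N V ip F \<longleftrightarrow>
     (\<forall>d. F d \<in> V) \<and> (\<forall>d d'. d \<noteq> d' \<longrightarrow> ip (F d) (F d') = 0\<^sub>m N N)"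

text \<open>
  The weight is continuous with finitely many zeros, so the pairing is definite on continuous
  functions, and on square-integrable ones modulo almost everywhere equality.
\<close>

definition cont_funs :: "real \<Rightarrow> (cmat2 \<times> cmat2 \<Rightarrow> complex mat) set" where
  "cont_funs l = {\<Phi>. (\<forall>a\<in>A_star. \<Phi> a \<in> carrier_mat (dimH l) (dimH l)) \<and>
     (\<forall>i<dimH l. \<forall>j<dimH l. continuous_on A_star (\<lambda>a. \<Phi> a $$ (i, j)))}"

definition L2_funs ::
  "(cmat2 \<times> cmat2) measure \<Rightarrow> real \<Rightarrow> (cmat2 \<times> cmat2 \<Rightarrow> complex mat) set" where
  "L2_funs \<mu> l = {\<Phi>. (\<forall>a\<in>A_star. \<Phi> a \<in> carrier_mat (dimH l) (dimH l)) \<and>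
     (\<forall>i<dimH l. \<forall>j<dimH l. (\<lambda>a. \<Phi> a $$ (i, j)) \<in> borel_measurable \<mu> \<and>
        integrable \<mu> (\<lambda>a. (cmod (\<Phi> a $$ (i, j)))\<^sup>2 * \<bar>D_star a\<bar>))}"

definition pairing ::
  "(cmat2 \<times> cmat2) measure \<Rightarrow> real \<Rightarrow> (cmat2 \<times> cmat2 \<Rightarrow> complex mat) \<Rightarrow>
   (cmat2 \<times> cmat2 \<Rightarrow> complex mat) \<Rightarrow> complex mat" where
  "pairing \<mu> l \<Phi> \<Psi> = Matrix.mat (dimH l) (dimH l)
     (\<lambda>(i, j). complex_of_real (2 / pi) *
        (LINT a|\<mu>. (\<Phi> a * mat_adjoint (\<Psi> a)) $$ (i, j) * complex_of_real \<bar>D_star a\<bar>))"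

end

theory Submission
  imports Defs
begin

text \<open>
  That the pairing is a matrix-valued inner product is soft: sesquilinearity and symmetry are
  inherited entrywise from the scalar pairing \<open>weighted_ip\<close>, the form \<open>\<langle>\<Phi>, \<Phi>\<rangle>\<close> evaluated on a vector
  is a sum of integrals of squared moduli, and definiteness holds because the weight \<open>sin\<^sup>2 t\<close>
  vanishes only on a null set and because an invariant measure charges every open arc.

  For the orthogonality write \<open>\<Phi>, \<Phi>'\<close> for the spherical functions in row \<open>p\<close> of degree \<open>d\<close> and in
  row \<open>p'\<close> of degree \<open>d'\<close>, and \<open>c, c'\<close> for their Clebsch--Gordan coefficients. Conceptually,
  \<open>tr (\<Phi>(x) \<Phi>'(x)\<^sup>*)\<close> is a matrix coefficient \<open>\<langle>x B, B\<rangle>\<close> of \<open>Hom (V, V')\<close>, where \<open>V, V'\<close> are the two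
  inequivalent irreducible modules of \<open>K \<times> K\<close> and \<open>B = \<beta>' \<circ> \<beta>\<^sup>*\<close> commutes with the diagonal \<open>K\<close>. Since
  \<open>Hom (V, V')\<close> has no invariants, Schur orthogonality kills its integral over \<open>K \<times> K\<close>, and
  integration along \<open>K A\<^sub>* K\<close> turns this into the integral over \<open>A\<^sub>*\<close> with weight \<open>sin\<^sup>2 t\<close>. The proof
  below carries out this argument with finite sums. The weight has only the frequencies \<open>0\<close> and
  \<open>\<plusminus> 2\<close>, and on \<open>A\<^sub>*\<close> the trace is a Fourier sum whose coefficient of frequency \<open>2 s\<close> is the squared
  norm \<open>|B\<^sub>s|\<^sup>2\<close> of a weight component of \<open>B\<close> (it is called \<open>overlap\<close>). So everything reduces to
  \<open>2 |B\<^sub>0|\<^sup>2 = |B\<^sub>1|\<^sup>2 + |B\<^sub>-\<^sub>1|\<^sup>2\<close>. When \<open>\<ell>\<^sub>1' - \<ell>\<^sub>1\<close> is not an integer, all frequencies are odd and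
  the integral vanishes.

  Now let \<open>E\<^sub>1, F\<^sub>1, E\<^sub>2, F\<^sub>2\<close> be the raising and lowering operators on the two tensor factors of
  \<open>Hom (V, V') = Hom (H\<^sup>\<ell>\<^sup>1, H\<^sup>\<ell>\<^sup>1\<^sup>') \<otimes> Hom (H\<^sup>\<ell>\<^sup>2, H\<^sup>\<ell>\<^sup>2\<^sup>')\<close>. Invariance of \<open>B\<close> reads \<open>E\<^sub>2 B\<^sub>0 = - E\<^sub>1 B\<^sub>-\<^sub>1\<close>
  and \<open>F\<^sub>1 B\<^sub>0 = - F\<^sub>2 B\<^sub>-\<^sub>1\<close>. If \<open>\<ell>\<^sub>1 < \<ell>\<^sub>1'\<close> then \<open>E\<^sub>1\<close> is bijective from weight \<open>-1\<close> to weight \<open>0\<close> of the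
  first factor, so \<open>B\<^sub>0 = E\<^sub>1 N\<close>; injectivity forces \<open>E\<^sub>2 N = - B\<^sub>-\<^sub>1\<close>, and
  \<open>|B\<^sub>0|\<^sup>2 = \<langle>E\<^sub>1 N, B\<^sub>0\<rangle> = \<langle>N, F\<^sub>1 B\<^sub>0\<rangle> = - \<langle>N, F\<^sub>2 B\<^sub>-\<^sub>1\<rangle> = - \<langle>E\<^sub>2 N, B\<^sub>-\<^sub>1\<rangle> = |B\<^sub>-\<^sub>1|\<^sup>2\<close>.
  This is \<open>coupled_overlap_one_step\<close>. The other component and the other orders of the spins follow
  from the symmetries of the recurrences, and since \<open>\<ell>\<^sub>1 + \<ell>\<^sub>2 - \<ell> = d\<close> differs from \<open>d'\<close>, at least
  one of the two pairs of spins is unequal. The recurrences themselves are read off from Racah's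
  formula through the generating function \<open>(1 - x y)\<^sup>D (1 + x)\<^sup>P (1 + y)\<^sup>Q\<close> (\<open>racah_coeff_raise\<close>).
\<close>

section \<open>Overlap identity for coupled arrays\<close>

text \<open>
  The intertwining relations of an \<open>SU(2)\<close>-embedding \<open>H\<^sup>\<ell> \<rightarrow> H\<^sup>\<ell>\<^sup>1 \<otimes> H\<^sup>\<ell>\<^sup>2\<close> for the raising and the
  lowering operator. The first index is the codegree \<open>x = \<ell>\<^sub>1 - j\<^sub>1\<close> and the second the degree
  \<open>y = \<ell>\<^sub>2 + j\<^sub>2\<close>, so that \<open>y - x\<close> determines the total weight; \<open>a x\<close>, \<open>b y\<close> and \<open>u z\<close> are the matrix
  entries of the ladder operators between neighbouring weights on the three modules.
\<close>

definition coupled ::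
  "(int \<Rightarrow> real) \<Rightarrow> (int \<Rightarrow> real) \<Rightarrow> (int \<Rightarrow> real) \<Rightarrow> (int \<Rightarrow> int \<Rightarrow> real) \<Rightarrow> bool" where
  "coupled a b u c \<longleftrightarrow>
     (\<forall>x y. u (y - x - 1) * c x y = a x * c (x + 1) y + b (y - 1) * c x (y - 1)) \<and>
     (\<forall>x y. u (y - x) * c x y = a (x - 1) * c (x - 1) y + b y * c x (y + 1))"

lemma coupled_raise:
  "coupled a b u c \<Longrightarrow> u (y - x - 1) * c x y = a x * c (x + 1) y + b (y - 1) * c x (y - 1)"
  by (simp add: coupled_def)

lemma coupled_lower:
  "coupled a b u c \<Longrightarrow> u (y - x) * c x y = a (x - 1) * c (x - 1) y + b y * c x (y + 1)"
  by (simp add: coupled_def)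

text \<open>Exchanging the two factors and, simultaneously, raising with lowering.\<close>

lemma coupled_transpose:
  assumes "coupled a b u c"
  shows "coupled b a (\<lambda>z. u (- z - 1)) (\<lambda>x y. c y x)"
  unfolding coupled_def
proof (intro conjI allI)
  fix x y
  show "u (- (y - x - 1) - 1) * c y x = b x * c y (x + 1) + a (y - 1) * c (y - 1) x"
    using coupled_lower[OF assms, of x y] by (simp add: algebra_simps)
  show "u (- (y - x) - 1) * c y x = b (x - 1) * c y (x - 1) + a y * c (y + 1) x"
    using coupled_raise[OF assms, of x y] by (simp add: algebra_simps)
qed

text \<open>Exchanging the two factors alone; this reverses the direction of both indices.\<close>

lemma coupled_mirror:
  assumes "coupled a b u c"
  shows "coupled (\<lambda>x. b (- x - 1)) (\<lambda>y. a (- y - 1)) u (\<lambda>x y. c (- y) (- x))"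
  unfolding coupled_def
proof (intro conjI allI)
  fix x y
  show "u (y - x - 1) * c (- y) (- x)
      = b (- x - 1) * c (- y) (- (x + 1)) + a (- (y - 1) - 1) * c (- (y - 1)) (- x)"
  proof -
    have e: "- x - - y - 1 = y - x - 1" "- (y - 1) - 1 = - y" "- (x + 1) = - x - 1" "- (y - 1) = - y + 1"
      by simp_all
    show ?thesis
      using coupled_raise[OF assms, of "-x" "-y"] unfolding e by simp
  qed
  show "u (y - x) * c (- y) (- x)
      = b (- (x - 1) - 1) * c (- y) (- (x - 1)) + a (- y - 1) * c (- (y + 1)) (- x)"
  proof -
    have e: "- x - - y = y - x" "- (x - 1) - 1 = - x" "- (x - 1) = - x + 1" "- (y + 1) = - y - 1"
      by simp_all
    show ?thesis
      using coupled_lower[OF assms, of "-x" "-y"] unfolding e by simp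
  qed
qed

lemma coupled_shift:
  assumes "coupled a b u c"
  shows "coupled (\<lambda>x. a (x + e)) (\<lambda>y. b (y + f)) (\<lambda>z. u (z + (f - e))) (\<lambda>x y. c (x + e) (y + f))"
  unfolding coupled_def
proof (intro conjI allI)
  fix x y
  show "u (y - x - 1 + (f - e)) * c (x + e) (y + f)
      = a (x + e) * c (x + 1 + e) (y + f) + b (y - 1 + f) * c (x + e) (y - 1 + f)"
    using coupled_raise[OF assms, of "y+f" "x+e"] by (simp add: algebra_simps)
  show "u (y - x + (f - e)) * c (x + e) (y + f)
      = a (x - 1 + e) * c (x - 1 + e) (y + f) + b (y + f) * c (x + e) (y + 1 + f)"
    using coupled_lower[OF assms, of "y+f" "x+e"] by (simp add: algebra_simps)
qed

text \<open>
  The raising operator on the weight spaces of \<open>Hom (H\<^sup>\<ell>\<^sup>1, H\<^sup>\<ell>\<^sup>1\<^sup>')\<close> is bidiagonal; nonzero diagonal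
  entries make it bijective. The condition at \<open>hi\<close> says that the recursion stops there without a
  remainder.
\<close>

lemma bidiagonal_solvable:
  fixes a a' g :: "int \<Rightarrow> real"
  assumes ne: "\<And>x. lo \<le> x \<Longrightarrow> x \<le> hi \<Longrightarrow> a' x \<noteq> 0" and ahi: "a hi = 0"
    and g: "\<And>x. x < lo \<or> hi < x \<Longrightarrow> g x = 0"
  obtains N where "\<And>x. x < lo \<or> hi < x \<Longrightarrow> N x = 0"
    and "\<And>x. a' x * N x - a (x - 1) * N (x - 1) = g x"
proof -
  define n where "n = rec_nat (g lo / a' lo)
     (\<lambda>k r. (g (lo + int (Suc k)) + a (lo + int k) * r) / a' (lo + int (Suc k)))"
  define N where "N x = (if lo \<le> x \<and> x \<le> hi then n (nat (x - lo)) else 0)" for x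
  have out: "N x = 0" if "x < lo \<or> hi < x" for x
    using that by (auto simp: N_def)
  have "a' x * N x - a (x - 1) * N (x - 1) = g x" for x
  proof -
    consider "x < lo" | "x = lo" "x \<le> hi" | "lo < x" "x \<le> hi" | "x = hi + 1" | "hi + 1 < x"
      by linarith
    then show ?thesis
    proof cases
      case 3
      define k where "k = nat (x - lo - 1)"
      have x: "x = lo + int (Suc k)" "nat (x - lo) = Suc k" "nat (x - 1 - lo) = k"
        "x - 1 = lo + int k"
        using 3 by (auto simp: k_def)
      have "n (Suc k) = (g x + a (x - 1) * n k) / a' x"
        unfolding n_def x(4) by (simp add: x(1) algebra_simps)
      moreover have "N x = n (Suc k)" "N (x - 1) = n k" using 3 x by (auto simp: N_def)
      ultimately show ?thesis using 3 ne[of x] by simp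
    next
      case 2
      then show ?thesis using ne[of x] by (simp add: N_def n_def)
    qed (auto simp: N_def g ahi)
  qed
  with out show thesis by (rule that)
qed

lemma bidiagonal_injective:
  fixes a a' M :: "int \<Rightarrow> real"
  assumes ne: "\<And>x. lo \<le> x \<Longrightarrow> x \<le> hi \<Longrightarrow> a' x \<noteq> 0"
    and out: "\<And>x. x < lo \<or> hi < x \<Longrightarrow> M x = 0"
    and eq: "\<And>x. a' x * M x = a (x - 1) * M (x - 1)"
  shows "M x = 0"
proof -
  have "M (lo + int k) = 0" for k
  proof (induction k)
    case 0
    show ?case using eq[of lo] out[of "lo - 1"] out[of lo] ne[of lo] by force
  next
    case (Suc k)
    show ?case
      using eq[of "lo + int (Suc k)"] Suc out[of "lo + int (Suc k)"] ne[of "lo + int (Suc k)"]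
      by (force simp: algebra_simps)
  qed
  from this[of "nat (x - lo)"] out[of x] show ?thesis by (cases "x < lo") auto
qed

lemma sum_int_interval_shift:
  fixes g :: "int \<Rightarrow> real"
  assumes "g (lo - 1) = 0" "g hi = 0"
  shows "(\<Sum>x\<in>{lo..hi}. g (x - 1)) = (\<Sum>x\<in>{lo..hi}. g x)"
proof -
  have "(\<Sum>x\<in>{lo..hi}. g (x - 1)) = (\<Sum>x\<in>{lo-1..hi-1}. g x)"
    by (rule sum.reindex_bij_witness[of _ "\<lambda>x. x + 1" "\<lambda>x. x - 1"]) auto
  also have "\<dots> = (\<Sum>x\<in>{lo-1..hi}. g x)"
  proof (rule sum.mono_neutral_left)
    show "\<forall>x\<in>{lo - 1..hi} - {lo - 1..hi - 1}. g x = 0"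
    proof
      fix x assume "x \<in> {lo - 1..hi} - {lo - 1..hi - 1}"
      then have "x = hi" by auto
      then show "g x = 0" using assms by simp
    qed
  qed auto
  also have "\<dots> = (\<Sum>x\<in>{lo..hi}. g x)"
  proof (rule sum.mono_neutral_right)
    show "\<forall>x\<in>{lo - 1..hi} - {lo..hi}. g x = 0"
    proof
      fix x assume "x \<in> {lo - 1..hi} - {lo..hi}"
      then have "x = lo - 1" by auto
      then show "g x = 0" using assms by simp
    qed
  qed auto
  finally show ?thesis .
qed

text \<open>
  The key identity \<open>|B\<^sub>0|\<^sup>2 = |B\<^sub>-\<^sub>1|\<^sup>2\<close>, with \<open>B0\<close> and \<open>B1\<close> for the two weight components. The assumption on
  \<open>a'\<close> makes \<open>E\<^sub>1\<close> bijective and holds if the first spin of \<open>c'\<close> is larger than that of \<open>c\<close>. For equal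
  pairs of spins the identity fails, because \<open>B\<close> then has a component along the identity map.
\<close>

lemma coupled_overlap_one_step:
  assumes c: "coupled a b u c" and c': "coupled a' b' u c'"
    and out: "\<And>x y. x < lo \<or> hi < x \<or> y < lo2 \<or> hi2 < y \<Longrightarrow> c x y = 0"
    and ahi: "a hi = 0" and ne: "\<And>x. lo \<le> x \<Longrightarrow> x \<le> hi \<Longrightarrow> a' x \<noteq> 0"
  shows "(\<Sum>x\<in>{lo..hi}. \<Sum>y\<in>{lo2..hi2}. (c x y * c' (x + 1) (y + 1))\<^sup>2)
       = (\<Sum>x\<in>{lo..hi}. \<Sum>y\<in>{lo2..hi2}. (c x y * c' x y)\<^sup>2)"
proof -
  define B0 where "B0 x y = c' x y * c x y" for x y
  define B1 where "B1 x y = c' (x + 1) (y + 1) * c x y" for x y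
  have "\<exists>N. (\<forall>x. (x < lo \<or> hi < x) \<longrightarrow> N x = 0) \<and>
       (\<forall>x. a' x * N x - a (x - 1) * N (x - 1) = B0 x y)" for y
    by (rule bidiagonal_solvable[of lo hi a' a "\<lambda>x. B0 x y"]) (use out ahi ne in \<open>auto simp: B0_def\<close>)
  then obtain N' where N': "\<And>y x. x < lo \<or> hi < x \<Longrightarrow> N' y x = 0"
    "\<And>y x. a' x * N' y x - a (x - 1) * N' y (x - 1) = B0 x y" by metis
  define N where "N x y = N' y x" for x y
  have Nout: "N x y = 0" if "x < lo \<or> hi < x" for x y using N' that by (simp add: N_def)
  have N0: "a' x * N x y - a (x - 1) * N (x - 1) y = B0 x y" for x y using N' by (simp add: N_def)
  \<comment> \<open>Rows outside the support of \<open>c\<close> solve the homogeneous recursion.\<close>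
  have Nout2: "N x y = 0" if "y < lo2 \<or> hi2 < y" for x y
  proof (rule bidiagonal_injective[of lo hi a' "\<lambda>x. N x y" a])
    fix x show "a' x * N x y = a (x - 1) * N (x - 1) y"
      using N0[of x y] out[of x y] that by (auto simp: B0_def)
  qed (use ne Nout in auto)
  \<comment> \<open>Invariance of \<open>B\<close>: raise \<open>c'\<close> and lower \<open>c\<close> in \<open>R1\<close>, the reverse in \<open>R2\<close>.\<close>
  have R1: "b' y * B0 x y - b y * B0 x (y + 1) = - (a' x * B1 x y - a (x - 1) * B1 (x - 1) y)" for x y
  proof -
    have "c x y * (a' x * c' (x + 1) (y + 1) + b' y * c' x y) = c x y * (u (y - x) * c' x (y + 1))"
      using coupled_raise[OF c', of "y + 1" x] by simp
    also have "\<dots> = c' x (y + 1) * (u (y - x) * c x y)" by simp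
    also have "\<dots> = c' x (y + 1) * (a (x - 1) * c (x - 1) y + b y * c x (y + 1))"
      using coupled_lower[OF c, of y x] by simp
    finally show ?thesis by (simp add: B0_def B1_def algebra_simps)
  qed
  have R2: "a' x * B0 x y - a x * B0 (x + 1) y = - (b' y * B1 x y - b (y - 1) * B1 x (y - 1))" for x y
  proof -
    have "c x y * (a' x * c' x y + b' y * c' (x + 1) (y + 1)) = c x y * (u (y - x - 1) * c' (x + 1) y)"
      using coupled_lower[OF c', of y "x + 1"] by (simp add: diff_diff_eq)
    also have "\<dots> = c' (x + 1) y * (u (y - x - 1) * c x y)" by simp
    also have "\<dots> = c' (x + 1) y * (a x * c (x + 1) y + b (y - 1) * c x (y - 1))"
      using coupled_raise[OF c, of y x] by simp
    finally show ?thesis by (simp add: B0_def B1_def algebra_simps)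
  qed
  \<comment> \<open>\<open>M = E\<^sub>2 N + B\<^sub>-\<^sub>1\<close> is in the kernel of \<open>E\<^sub>1\<close>, because \<open>E\<^sub>1\<close> and \<open>E\<^sub>2\<close> commute, \<open>E\<^sub>1 N = B\<^sub>0\<close> and \<open>E\<^sub>2 B\<^sub>0 = - E\<^sub>1 B\<^sub>-\<^sub>1\<close>.\<close>
  define M where "M x y = b' y * N x y - b y * N x (y + 1) + B1 x y" for x y
  have "M x y = 0" for x y
  proof (rule bidiagonal_injective[of lo hi a' "\<lambda>x. M x y" a])
    fix x
    have "a' x * M x y - a (x - 1) * M (x - 1) y
        = b' y * (a' x * N x y - a (x - 1) * N (x - 1) y)
          - b y * (a' x * N x (y + 1) - a (x - 1) * N (x - 1) (y + 1))
          + (a' x * B1 x y - a (x - 1) * B1 (x - 1) y)"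
      by (simp add: M_def algebra_simps)
    also have "\<dots> = 0" unfolding N0 using R1[of y x] by simp
    finally show "a' x * M x y = a (x - 1) * M (x - 1) y" by simp
  qed (use ne Nout out in \<open>auto simp: M_def B1_def\<close>)
  then have N1: "b' y * N x y - b y * N x (y + 1) = - B1 x y" for x y
    by (simp add: M_def add_eq_0_iff)
  have "(\<Sum>x\<in>{lo..hi}. \<Sum>y\<in>{lo2..hi2}. (B0 x y)\<^sup>2)
      = (\<Sum>y\<in>{lo2..hi2}. \<Sum>x\<in>{lo..hi}. B0 x y * (a' x * N x y - a (x - 1) * N (x - 1) y))"
    unfolding N0 by (subst sum.swap) (simp add: power2_eq_square)
  also have "\<dots> = (\<Sum>y\<in>{lo2..hi2}. \<Sum>x\<in>{lo..hi}. N x y * (a' x * B0 x y - a x * B0 (x + 1) y))"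
  proof (rule sum.cong[OF refl])
    fix y
    have "(\<Sum>x\<in>{lo..hi}. B0 x y * (a (x - 1) * N (x - 1) y)) = (\<Sum>x\<in>{lo..hi}. B0 (x + 1) y * (a x * N x y))"
      using sum_int_interval_shift[of "\<lambda>x. B0 (x + 1) y * (a x * N x y)" lo hi] Nout ahi by simp
    then show "(\<Sum>x\<in>{lo..hi}. B0 x y * (a' x * N x y - a (x - 1) * N (x - 1) y))
      = (\<Sum>x\<in>{lo..hi}. N x y * (a' x * B0 x y - a x * B0 (x + 1) y))"
      by (simp add: algebra_simps sum_subtractf)
  qed
  also have "\<dots> = (\<Sum>x\<in>{lo..hi}. \<Sum>y\<in>{lo2..hi2}. N x y * (- (b' y * B1 x y - b (y - 1) * B1 x (y - 1))))"
    unfolding R2 by (rule sum.swap)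
  also have "\<dots> = (\<Sum>x\<in>{lo..hi}. \<Sum>y\<in>{lo2..hi2}. B1 x y * - (b' y * N x y - b y * N x (y + 1)))"
  proof (rule sum.cong[OF refl])
    fix x
    have "(\<Sum>y\<in>{lo2..hi2}. b (y - 1) * B1 x (y - 1) * N x y) = (\<Sum>y\<in>{lo2..hi2}. b y * B1 x y * N x (y + 1))"
      using sum_int_interval_shift[of "\<lambda>y. b y * B1 x y * N x (y + 1)" lo2 hi2] Nout2 out
      by (simp add: B1_def)
    then show "(\<Sum>y\<in>{lo2..hi2}. N x y * (- (b' y * B1 x y - b (y - 1) * B1 x (y - 1))))
      = (\<Sum>y\<in>{lo2..hi2}. B1 x y * - (b' y * N x y - b y * N x (y + 1)))"
      by (simp add: algebra_simps sum_subtractf)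
  qed
  also have "\<dots> = (\<Sum>x\<in>{lo..hi}. \<Sum>y\<in>{lo2..hi2}. (B1 x y)\<^sup>2)"
    unfolding N1 by (simp add: power2_eq_square)
  finally show ?thesis by (simp add: B0_def B1_def mult.commute)
qed

text \<open>
  Squared norm of the component of \<open>B = \<beta>' \<circ> \<beta>\<^sup>*\<close> that lowers \<open>j\<^sub>1\<close> and raises \<open>j\<^sub>2\<close> by \<open>s\<close>. An unrestricted sum makes the
  symmetries plain substitutions; in all applications only finitely many terms are nonzero.
\<close>

definition overlap :: "(int \<Rightarrow> int \<Rightarrow> real) \<Rightarrow> (int \<Rightarrow> int \<Rightarrow> real) \<Rightarrow> int \<Rightarrow> real" where
  "overlap c c' s = (\<Sum>\<^sub>\<infinity>(x, y)\<in>UNIV. (c x y)\<^sup>2 * (c' (x + s) (y + s))\<^sup>2)"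

lemma overlap_commute: "overlap c c' s = overlap c' c (- s)"
  unfolding overlap_def
  by (rule infsum_reindex_bij_witness[of _ "\<lambda>(x, y). (x - s, y - s)" "\<lambda>(x, y). (x + s, y + s)"]) auto

lemma overlap_transpose: "overlap (\<lambda>x y. c y x) (\<lambda>x y. c' y x) s = overlap c c' s"
  unfolding overlap_def
  by (rule infsum_reindex_bij_witness[of _ "\<lambda>(x, y). (y, x)" "\<lambda>(x, y). (y, x)"]) auto

lemma overlap_mirror:
  "overlap (\<lambda>x y. c (- y) (- x)) (\<lambda>x y. c' (- y) (- x)) s = overlap c c' (- s)"
  unfolding overlap_def
  by (rule infsum_reindex_bij_witness[of _ "\<lambda>(x, y). (- y, - x)" "\<lambda>(x, y). (- y, - x)"]) auto

lemma overlap_box: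
  assumes "\<And>x y. x < lo \<or> hi < x \<or> y < lo2 \<or> hi2 < y \<Longrightarrow> c x y = 0"
  shows "overlap c c' s = (\<Sum>x\<in>{lo..hi}. \<Sum>y\<in>{lo2..hi2}. (c x y)\<^sup>2 * (c' (x + s) (y + s))\<^sup>2)"
proof -
  have "overlap c c' s = (\<Sum>\<^sub>\<infinity>(x, y)\<in>{lo..hi}\<times>{lo2..hi2}. (c x y)\<^sup>2 * (c' (x + s) (y + s))\<^sup>2)"
    unfolding overlap_def by (rule infsum_cong_neutral) (use assms in \<open>force simp: not_le\<close>)+
  then show ?thesis by (simp add: sum.cartesian_product)
qed

lemma overlap_identity_first:
  assumes c: "coupled a b u c" and c': "coupled a' b' u c'"
    and out: "\<And>x y. x < lo \<or> hi < x \<or> y < lo2 \<or> hi2 < y \<Longrightarrow> c x y = 0"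
    and "a hi = 0" "\<And>x. lo \<le> x \<Longrightarrow> x \<le> hi \<Longrightarrow> a' x \<noteq> 0"
  shows "overlap c c' 1 = overlap c c' 0"
  using coupled_overlap_one_step[OF assms]
  by (simp add: overlap_box[of lo hi lo2 hi2 c, OF out] power_mult_distrib)

section \<open>The recurrences behind the Clebsch--Gordan coefficients\<close>

text \<open>Binomial coefficients extended by zero, so that recurrences need no side conditions.\<close>

definition zbinomial :: "nat \<Rightarrow> int \<Rightarrow> real" where
  "zbinomial n a = (if a < 0 then 0 else real (n choose nat a))"

text \<open>
  The coefficient of \<open>x\<^sup>a y\<^sup>b\<close> in \<open>(1 - x y)\<^sup>D (1 + x)\<^sup>P (1 + y)\<^sup>Q\<close>. Up to factorials this is the sum in
  Racah's formula, with \<open>D = \<ell>\<^sub>1 + \<ell>\<^sub>2 - \<ell>\<close>, \<open>P = \<ell> + \<ell>\<^sub>1 - \<ell>\<^sub>2\<close> and \<open>Q = \<ell> - \<ell>\<^sub>1 + \<ell>\<^sub>2\<close>.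
\<close>

fun racah_coeff :: "nat \<Rightarrow> nat \<Rightarrow> nat \<Rightarrow> int \<Rightarrow> int \<Rightarrow> real" where
  "racah_coeff 0 P Q a b = zbinomial P a * zbinomial Q b"
| "racah_coeff (Suc D) P Q a b = racah_coeff D P Q a b - racah_coeff D P Q (a - 1) (b - 1)"

lemma zbinomial_outside: "a < 0 \<or> int n < a \<Longrightarrow> zbinomial n a = 0"
  by (auto simp: zbinomial_def)

lemma zbinomial_absorb: "of_int (a + 1) * zbinomial n (a + 1) = of_int (int n - a) * zbinomial n a"
proof (cases "a < 0")
  case True
  then have "a + 1 < 0 \<or> a + 1 = 0" by linarith
  with True show ?thesis by (auto simp: zbinomial_def)
next
  case False
  define k where "k = nat a"
  have a: "a = int k" using False by (simp add: k_def)
  have "nat (a + 1) = Suc k" using a by simp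
  moreover have "Suc k * (n choose Suc k) = (n - k) * (n choose k)"
  proof (cases n)
    case (Suc m)
    have "Suc k * (Suc m choose Suc k) = Suc m * (m choose k)"
      using Suc_times_binomial_eq[of m k] by simp
    moreover have "(Suc m - k) * (Suc m choose k) = Suc m * (m choose k)"
      using binomial_absorb_comp[of "Suc m" k] by simp
    ultimately show ?thesis using Suc by simp
  qed auto
  then have "real (Suc k) * real (n choose Suc k) = real (n - k) * real (n choose k)"
    by (metis of_nat_mult)
  moreover have "real (n - k) * real (n choose k) = (real n - real k) * real (n choose k)"
    by (cases "k \<le> n") (auto simp: of_nat_diff)
  ultimately show ?thesis using a False by (simp add: zbinomial_def add.commute)
qed

lemma racah_coeff_transpose: "racah_coeff D P Q a b = racah_coeff D Q P b a"
  by (induction D arbitrary: a b) auto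

lemma racah_coeff_outside:
  assumes "a < 0 \<or> int (D + P) < a \<or> b < 0 \<or> int (D + Q) < b \<or> int P < a - b \<or> int Q < b - a"
  shows "racah_coeff D P Q a b = 0"
  using assms by (induction D arbitrary: a b) (auto simp: zbinomial_def)

text \<open>
  In terms of the generating function \<open>G\<close> this is the differential equation
  \<open>P G + y (1 + y) G\<^sub>y = (1 + x) G\<^sub>x + (D + Q) y G\<close>. The induction on \<open>D\<close> multiplies \<open>G\<close> by one more
  factor \<open>1 - x y\<close>.
\<close>

lemma racah_coeff_raise:
  "of_int (int P - a + b) * racah_coeff D P Q a b
     = of_int (a + 1) * racah_coeff D P Q (a + 1) b
     + of_int (int (D + Q) - b + 1) * racah_coeff D P Q a (b - 1)"
proof (induction D arbitrary: a b)
  case 0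
  show ?case
  proof -
    have P: "of_int (a + 1) * zbinomial P (a + 1) * zbinomial Q b = of_int (int P - a) * zbinomial P a * zbinomial Q b"
      using zbinomial_absorb[of a P] by simp
    have Q: "zbinomial P a * (of_int b * zbinomial Q b) = zbinomial P a * (of_int (int Q - b + 1) * zbinomial Q (b - 1))"
    proof -
      have "of_int b * zbinomial Q b = of_int (int Q - b + 1) * zbinomial Q (b - 1)"
        using zbinomial_absorb[of "b - 1" Q] by (simp add: algebra_simps)
      then show ?thesis by (simp only:)
    qed
    show ?thesis using P Q by (simp add: algebra_simps)
  qed
next
  case (Suc D)
  show ?case
    using Suc[of a b] Suc[of "a - 1" "b - 1"] by (simp add: algebra_simps)
qed

lemma racah_coeff_sum:
  "racah_coeff D P Q a b
     = (\<Sum>k\<le>D. (- 1) ^ k * real (D choose k) * zbinomial P (a - int k) * zbinomial Q (b - int k))"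
proof (induction D arbitrary: a b)
  case (Suc D)
  let ?t = "\<lambda>k. zbinomial P (a - int k) * zbinomial Q (b - int k)"
  have "(\<Sum>k\<le>Suc D. (- 1) ^ k * real (Suc D choose k) * ?t k)
      = ?t 0 + (\<Sum>k\<le>D. (- 1) ^ Suc k * real ((D choose Suc k) + (D choose k)) * ?t (Suc k))"
    by (subst sum.atMost_Suc_shift) (simp add: add.commute)
  also have "\<dots> = (?t 0 + (\<Sum>k\<le>D. (- 1) ^ Suc k * real (D choose Suc k) * ?t (Suc k)))
      - (\<Sum>k\<le>D. (- 1) ^ k * real (D choose k) * ?t (Suc k))"
  proof -
    have "(- 1) ^ Suc k * real ((D choose Suc k) + (D choose k)) * ?t (Suc k)
        = (- 1) ^ Suc k * real (D choose Suc k) * ?t (Suc k)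
          - (- 1) ^ k * real (D choose k) * ?t (Suc k)" for k
      by (simp add: algebra_simps)
    then show ?thesis by (simp only: sum_subtractf)
  qed
  also have "?t 0 + (\<Sum>k\<le>D. (- 1) ^ Suc k * real (D choose Suc k) * ?t (Suc k))
      = (\<Sum>k\<le>Suc D. (- 1) ^ k * real (D choose k) * ?t k)"
    by (subst sum.atMost_Suc_shift) simp
  also have "\<dots> = (\<Sum>k\<le>D. (- 1) ^ k * real (D choose k) * ?t k)" by simp
  also have "\<dots> = racah_coeff D P Q a b" unfolding Suc by (simp add: mult.assoc)
  also have "(\<Sum>k\<le>D. (- 1) ^ k * real (D choose k) * ?t (Suc k)) = racah_coeff D P Q (a - 1) (b - 1)"
    unfolding Suc by (rule sum.cong) (simp_all add: algebra_simps)
  finally show ?case by (simp add: mult.assoc)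
qed simp

definition ifact :: "int \<Rightarrow> real" where
  "ifact z = fact (nat z)"

lemma ifact_pos [simp]: "0 < ifact z" by (simp add: ifact_def)

lemma ifact_rec: "1 \<le> z \<Longrightarrow> ifact z = of_int z * ifact (z - 1)"
proof -
  assume z: "1 \<le> z"
  then have "nat z = Suc (nat (z - 1))" by simp
  then show ?thesis using z unfolding ifact_def by simp
qed

text \<open>
  Matrix entry of the ladder operators on the module of dimension \<open>n + 1\<close>, between the basis vectors
  of degree \<open>x\<close> and \<open>x + 1\<close>. Truncation at \<open>0\<close> lets it vanish outside the module as well.
\<close>

definition ladder :: "int \<Rightarrow> int \<Rightarrow> real" where
  "ladder n x = sqrt (max 0 (of_int ((x + 1) * (n - x))))"

lemma ladder_end: "ladder n n = 0" "ladder n (- 1) = 0"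
  by (simp_all add: ladder_def)

lemma ladder_ne_0: "0 \<le> x \<Longrightarrow> x < n \<Longrightarrow> ladder n x \<noteq> 0"
  by (simp add: ladder_def max_def)

text \<open>
  Passing between the normalisations of two neighbouring coefficients; all three terms of the
  raising relation are instances.
\<close>

lemma sqrt_fact_step:
  assumes "0 \<le> x" "0 \<le> y"
  shows "sqrt (max 0 (of_int (x * (y + 1)))) * sqrt (ifact x * ifact y * r)
       = of_int x * sqrt (ifact (x - 1) * ifact (y + 1) * r)"
proof (cases "x = 0")
  case False
  then have x: "1 \<le> x" using assms by simp
  have "max 0 (real_of_int (x * (y + 1))) = of_int x * of_int (y + 1)"
    using assms by (simp add: max_def)
  moreover have "ifact (y + 1) = of_int (y + 1) * ifact y" using ifact_rec[of "y + 1"] assms by simp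
  moreover have "ifact x = of_int x * ifact (x - 1)" using ifact_rec[OF x] .
  ultimately have "max 0 (real_of_int (x * (y + 1))) * (ifact x * ifact y * r)
      = (of_int x)\<^sup>2 * (ifact (x - 1) * ifact (y + 1) * r)"
    by (simp add: power2_eq_square)
  then show ?thesis using x
    by (metis abs_of_nonneg assms(1) of_int_0_le_iff real_sqrt_abs real_sqrt_mult)
qed simp

text \<open>
  The Clebsch--Gordan coefficient without the factor that depends on the spins alone, in the
  coordinates \<open>a = \<ell>\<^sub>1 - j\<^sub>1\<close>, \<open>b = \<ell>\<^sub>2 + j\<^sub>2\<close>, for which \<open>\<ell> + j = P - a + b\<close> and \<open>\<ell> - j = Q + a - b\<close>.
\<close>

definition cg_core :: "nat \<Rightarrow> nat \<Rightarrow> nat \<Rightarrow> int \<Rightarrow> int \<Rightarrow> real" where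
  "cg_core D P Q a b =
     sqrt (ifact (int P - a + b) * ifact (int Q + a - b) *
           (ifact a * ifact (int (D + P) - a) * (ifact b * ifact (int (D + Q) - b))))
     * racah_coeff D P Q a b"

lemma cg_core_outside:
  assumes "a < 0 \<or> int (D + P) < a \<or> b < 0 \<or> int (D + Q) < b \<or> int P < a - b \<or> int Q < b - a"
  shows "cg_core D P Q a b = 0"
  using racah_coeff_outside[OF assms] by (simp add: cg_core_def)

lemma cg_core_transpose: "cg_core D P Q a b = cg_core D Q P b a"
  unfolding cg_core_def racah_coeff_transpose[of D P Q a b]
  by (simp add: algebra_simps)

text \<open>
  After division by the common square root \<open>Z\<close> each term is a term of \<open>racah_coeff_raise\<close>.
\<close>

lemma cg_core_raise:
  "ladder (int (P + Q)) (int P + (b - a - 1)) * cg_core D P Q a b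
     = ladder (int (D + P)) a * cg_core D P Q (a + 1) b
     + ladder (int (D + Q)) (b - 1) * cg_core D P Q a (b - 1)"
proof -
  define X where "X = int P - a + b"
  define Y where "Y = int Q + a - b"
  define A' where "A' = int (D + P) - a"
  define B' where "B' = int (D + Q) - b"
  define Z where "Z = sqrt (ifact (X - 1) * ifact (Y + 1) * (ifact a * ifact A' * (ifact b * ifact B')))"
  have 0: "ladder (int (P + Q)) (int P + (b - a - 1)) * cg_core D P Q a b
      = Z * (of_int X * racah_coeff D P Q a b)"
  proof (cases "racah_coeff D P Q a b = 0")
    case False
    then have XY: "0 \<le> X" "0 \<le> Y" using racah_coeff_outside[of a D P b Q] by (force simp: X_def Y_def)+
    have "ladder (int (P + Q)) (int P + (b - a - 1)) = sqrt (max 0 (of_int (X * (Y + 1))))"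
      by (simp add: ladder_def X_def Y_def algebra_simps)
    then show ?thesis
      using sqrt_fact_step[OF XY, of "ifact a * ifact A' * (ifact b * ifact B')"]
      by (simp add: cg_core_def Z_def X_def Y_def A'_def B'_def)
  qed (simp add: cg_core_def)
  have 1: "ladder (int (D + P)) a * cg_core D P Q (a + 1) b
      = Z * (of_int (a + 1) * racah_coeff D P Q (a + 1) b)"
  proof (cases "racah_coeff D P Q (a + 1) b = 0")
    case False
    then have A: "0 \<le> a + 1" "0 \<le> A' - 1" using racah_coeff_outside[of "a + 1" D P b Q] by (force simp: A'_def)+
    have l: "ladder (int (D + P)) a = sqrt (max 0 (of_int ((a + 1) * (A' - 1 + 1))))"
      by (simp add: ladder_def A'_def)
    have "cg_core D P Q (a + 1) b = sqrt (ifact (a + 1) * ifact (A' - 1) *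
        (ifact (X - 1) * ifact (Y + 1) * (ifact b * ifact B'))) * racah_coeff D P Q (a + 1) b"
      by (simp add: cg_core_def X_def Y_def A'_def B'_def algebra_simps)
    moreover have "Z = sqrt (ifact (a + 1 - 1) * ifact (A' - 1 + 1) * (ifact (X - 1) * ifact (Y + 1) * (ifact b * ifact B')))"
      by (simp add: Z_def mult_ac)
    ultimately show ?thesis
      using sqrt_fact_step[OF A, of "ifact (X - 1) * ifact (Y + 1) * (ifact b * ifact B')"] l
      by simp
  qed (simp add: cg_core_def)
  have 2: "ladder (int (D + Q)) (b - 1) * cg_core D P Q a (b - 1)
      = Z * (of_int (B' + 1) * racah_coeff D P Q a (b - 1))"
  proof (cases "racah_coeff D P Q a (b - 1) = 0")
    case False
    then have B: "0 \<le> B' + 1" "0 \<le> b - 1" using racah_coeff_outside[of a D P "b - 1" Q] by (force simp: B'_def)+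
    have l: "ladder (int (D + Q)) (b - 1) = sqrt (max 0 (of_int ((B' + 1) * (b - 1 + 1))))"
      by (simp add: ladder_def B'_def mult.commute algebra_simps)
    have "cg_core D P Q a (b - 1) = sqrt (ifact (B' + 1) * ifact (b - 1) *
        (ifact (X - 1) * ifact (Y + 1) * (ifact a * ifact A'))) * racah_coeff D P Q a (b - 1)"
      by (simp add: cg_core_def X_def Y_def A'_def B'_def algebra_simps)
    moreover have "Z = sqrt (ifact (B' + 1 - 1) * ifact (b - 1 + 1) * (ifact (X - 1) * ifact (Y + 1) * (ifact a * ifact A')))"
      by (simp add: Z_def mult_ac)
    ultimately show ?thesis
      using sqrt_fact_step[OF B, of "ifact (X - 1) * ifact (Y + 1) * (ifact a * ifact A')"] l
      by simp
  qed (simp add: cg_core_def)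
  show ?thesis
    unfolding 0 1 2 using racah_coeff_raise[of P a b D Q]
    by (simp add: X_def B'_def distrib_left[symmetric])
qed

lemma coupled_cg_core:
  "coupled (ladder (int (D + P))) (ladder (int (D + Q)))
     (\<lambda>z. ladder (int (P + Q)) (int P + z)) (cg_core D P Q)"
  unfolding coupled_def
proof (intro conjI allI)
  fix x y
  show "ladder (int (P + Q)) (int P + (y - x - 1)) * cg_core D P Q x y
      = ladder (int (D + P)) x * cg_core D P Q (x + 1) y
      + ladder (int (D + Q)) (y - 1) * cg_core D P Q x (y - 1)"
    by (rule cg_core_raise)
  have "ladder (int (P + Q)) (int P + (y - x)) = ladder (int (Q + P)) (int Q + (x - y - 1))"
    by (simp add: ladder_def algebra_simps)
  then show "ladder (int (P + Q)) (int P + (y - x)) * cg_core D P Q x y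
      = ladder (int (D + P)) (x - 1) * cg_core D P Q (x - 1) y
      + ladder (int (D + Q)) y * cg_core D P Q x (y + 1)"
    unfolding cg_core_transpose[of D P Q] using cg_core_raise[of Q P x y D]
    by (simp only: add.commute)
qed

text \<open>
  The hypotheses say that the weights of the module of \<open>c\<close> lie strictly inside those of the module
  of \<open>c'\<close>. Both directions of the shift are available because the reflection \<open>(x, y) \<mapsto> (-x, -y)\<close>,
  the composite of mirror and transposition, preserves this situation.
\<close>

lemma overlap_identity_nested:
  assumes c: "coupled (\<lambda>x. ladder n (x + e)) b u c"
    and c': "coupled (\<lambda>x. ladder n' (x + e')) b' u c'"
    and out: "\<And>x y. x + e < 0 \<or> n < x + e \<or> y < lo \<or> hi < y \<Longrightarrow> c x y = 0"
    and nested: "e < e'" "n - e < n' - e'"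
  shows "overlap c c' 1 = overlap c c' 0" "overlap c c' (- 1) = overlap c c' 0"
proof -
  show "overlap c c' 1 = overlap c c' 0"
    by (rule overlap_identity_first[OF c c', where lo = "- e" and hi = "n - e"])
       (use nested out in \<open>auto simp: ladder_end ladder_ne_0\<close>)
  let ?r = "\<lambda>c x y. c (- x) (- y) :: real"
  have r: "overlap (?r c) (?r c') s = overlap c c' (- s)" for s
    using overlap_mirror[of c c' s] overlap_transpose[of "\<lambda>x y. c (- y) (- x)" "\<lambda>x y. c' (- y) (- x)" s]
    by simp
  have "overlap (?r c) (?r c') 1 = overlap (?r c) (?r c') 0"
    by (rule overlap_identity_first[OF coupled_transpose[OF coupled_mirror[OF c]]
          coupled_transpose[OF coupled_mirror[OF c']], where lo = "e - n" and hi = e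
          and ?lo2.0 = "- hi" and ?hi2.0 = "- lo"])
       (use nested out in \<open>auto simp: ladder_end ladder_ne_0\<close>)
  then show "overlap c c' (- 1) = overlap c c' 0" unfolding r by simp
qed

text \<open>
  The shifts \<open>e = \<ell>\<^sub>1' - \<ell>\<^sub>1\<close> and \<open>f = \<ell>\<^sub>2' - \<ell>\<^sub>2\<close> align equal weights of the two embeddings of the same
  \<open>H\<^sup>\<ell>\<close>. They are not both zero, since \<open>e + f = D' - D\<close>; the four cases are related by exchanging the
  tensor factors and the two families.
\<close>

lemma cg_core_overlap:
  assumes PQ: "P + Q = P' + Q'"
    and e: "int (D' + P') = int (D + P) + 2 * e" and f: "int (D' + Q') = int (D + Q) + 2 * f"
    and "D \<noteq> D'"
  defines "c \<equiv> cg_core D P Q" and "c' \<equiv> \<lambda>x y. cg_core D' P' Q' (x + e) (y + f)"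
  shows "2 * overlap c c' 0 = overlap c c' 1 + overlap c c' (- 1)"
proof -
  define u where "u z = ladder (int (P + Q)) (int P + z)" for z
  have c: "coupled (\<lambda>x. ladder (int (D + P)) (x + 0)) (\<lambda>y. ladder (int (D + Q)) (y + 0)) u c"
    unfolding u_def c_def using coupled_cg_core[of D P Q] by simp
  have c': "coupled (\<lambda>x. ladder (int (D' + P')) (x + e)) (\<lambda>y. ladder (int (D' + Q')) (y + f)) u c'"
  proof -
    have "int (P' + Q') = int (P + Q)" using PQ by simp
    moreover have "int P' + (z + (f - e)) = int P + z" for z using PQ e f by simp
    ultimately have "ladder (int (P' + Q')) (int P' + (z + (f - e))) = u z" for z
      unfolding u_def by presburger
    then show ?thesis
      using coupled_shift[OF coupled_cg_core[of D' P' Q'], of e f] by (simp add: c'_def)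
  qed
  have out: "c x y = 0" if "x + 0 < 0 \<or> int (D + P) < x + 0 \<or> y + 0 < 0 \<or> int (D + Q) < y + 0" for x y
    using that by (auto simp: c_def intro!: cg_core_outside)
  have out': "c' x y = 0"
    if "x + e < 0 \<or> int (D' + P') < x + e \<or> y + f < 0 \<or> int (D' + Q') < y + f" for x y
    using that by (auto simp: c'_def intro!: cg_core_outside)
  have t: "overlap (\<lambda>x y. c y x) (\<lambda>x y. c' y x) s = overlap c c' s"
    and t': "overlap (\<lambda>x y. c' y x) (\<lambda>x y. c y x) s = overlap c' c s" for s
    by (rule overlap_transpose)+
  consider "0 < e" | "e < 0" | "0 < f" | "f < 0" using assms(1-4) by linarith
  then show ?thesis
  proof cases
    case 1
    have n: "0 < e" "int (D + P) - 0 < int (D' + P') - e" using 1 e by linarith+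
    show ?thesis
      using overlap_identity_nested[OF c c' out n] by simp
  next
    case 2
    have n: "e < 0" "int (D' + P') - e < int (D + P) - 0" using 2 e by linarith+
    have o: "c' x y = 0"
      if "x + e < 0 \<or> int (D' + P') < x + e \<or> y < - f \<or> int (D' + Q') - f < y" for x y
      using that by (intro out') linarith
    show ?thesis
      using overlap_identity_nested[OF c' c o n] by (simp add: overlap_commute[of c c'])
  next
    case 3
    have n: "0 < f" "int (D + Q) - 0 < int (D' + Q') - f" using 3 f by linarith+
    have o: "c y x = 0"
      if "x + 0 < 0 \<or> int (D + Q) < x + 0 \<or> y < 0 \<or> int (D + P) < y" for x y
      using that by (intro out) linarith
    show ?thesis
      using overlap_identity_nested[OF coupled_transpose[OF c] coupled_transpose[OF c'] o n]
      unfolding t by simp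
  next
    case 4
    have n: "f < 0" "int (D' + Q') - f < int (D + Q) - 0" using 4 f by linarith+
    have o: "c' y x = 0"
      if "x + f < 0 \<or> int (D' + Q') < x + f \<or> y < - e \<or> int (D' + P') - e < y" for x y
      using that by (intro out') linarith
    show ?thesis
      using overlap_identity_nested[OF coupled_transpose[OF c'] coupled_transpose[OF c] o n]
      unfolding t' by (simp add: overlap_commute[of c c'])
  qed
qed

section \<open>Identification with Racah's formula\<close>

lemma zbinomial_eq_fact: "0 \<le> a \<Longrightarrow> a \<le> int n \<Longrightarrow> zbinomial n a = fact n / (ifact a * ifact (int n - a))"
proof -
  assume a: "0 \<le> a" "a \<le> int n"
  have "nat (int n - a) = n - nat a" using a by simp
  then show ?thesis using a by (simp add: zbinomial_def ifact_def binomial_fact)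
qed

lemma rfact_of_int: "rfact (of_int z) = ifact z"
  by (simp add: rfact_def ifact_def)

text \<open>
  The first square root of Racah's formula, divided by the factorials that turn its sum into
  binomial coefficients.
\<close>

definition cg_norm :: "nat \<Rightarrow> nat \<Rightarrow> nat \<Rightarrow> real" where
  "cg_norm D P Q = sqrt (real (P + Q + 1) * fact P * fact Q * fact D / fact (D + P + Q + 1))
     / (fact D * fact P * fact Q)"

text \<open>
  The range of summation in Racah's formula is the set of all \<open>k\<close> for which none of the binomial
  coefficients vanishes.
\<close>

lemma racah_sum_eq:
  assumes a: "0 \<le> a" "a \<le> int (D + P)" and b: "0 \<le> b" "b \<le> int (D + Q)"
  shows "(\<Sum>k | int k \<le> int D \<and> int k \<le> a \<and> int k \<le> b \<and> 0 \<le> int P - a + int k \<and> 0 \<le> int Q - b + int k.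
            (- 1) ^ k / (fact k * ifact (int D - int k) * ifact (a - int k)
               * ifact (b - int k) * ifact (int P - a + int k) * ifact (int Q - b + int k)))
         = racah_coeff D P Q a b / (fact D * fact P * fact Q)" (is "(\<Sum>k | ?S k. ?f k) = _")
proof -
  let ?g = "\<lambda>k. (- 1) ^ k * real (D choose k) * zbinomial P (a - int k) * zbinomial Q (b - int k)"
  have "?f k = ?g k / (fact D * fact P * fact Q)" if "?S k" for k
  proof -
    have "zbinomial P (a - int k) = fact P / (ifact (a - int k) * ifact (int P - a + int k))"
      using that zbinomial_eq_fact[of "a - int k" P] by (simp add: algebra_simps)
    moreover have "zbinomial Q (b - int k) = fact Q / (ifact (b - int k) * ifact (int Q - b + int k))"
      using that zbinomial_eq_fact[of "b - int k" Q] by (simp add: algebra_simps)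
    moreover have "real (D choose k) = fact D / (fact k * ifact (int D - int k))"
      using that zbinomial_eq_fact[of "int k" D] by (simp add: zbinomial_def ifact_def)
    ultimately show ?thesis by (simp add: field_simps)
  qed
  then have "(\<Sum>k | ?S k. ?f k) = (\<Sum>k | ?S k. ?g k) / (fact D * fact P * fact Q)"
    by (simp add: sum_divide_distrib)
  also have "(\<Sum>k | ?S k. ?g k) = (\<Sum>k\<le>D. ?g k)"
  proof (rule sum.mono_neutral_left)
    show "\<forall>k\<in>{..D} - {k. ?S k}. ?g k = 0"
    proof
      fix k assume "k \<in> {..D} - {k. ?S k}"
      then have "(a - int k < 0 \<or> int P < a - int k) \<or> (b - int k < 0 \<or> int Q < b - int k)" by auto
      then show "?g k = 0" using zbinomial_outside[of "a - int k" P] zbinomial_outside[of "b - int k" Q] by auto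
    qed
  qed auto
  finally show ?thesis by (simp add: racah_coeff_sum)
qed

lemma CG_eq_cg_core:
  fixes D P Q :: nat and a b :: int
  assumes a: "0 \<le> a" "a \<le> int (D + P)" and b: "0 \<le> b" "b \<le> int (D + Q)"
    and l1: "l1 = real (D + P) / 2" and l2: "l2 = real (D + Q) / 2" and l: "l = real (P + Q) / 2"
    and j: "j = l1 - of_int a + (of_int b - l2)"
  shows "CG l1 l2 l (l1 - of_int a) (of_int b - l2) j = cg_norm D P Q * cg_core D P Q a b"
proof -
  have e: "2 * l + 1 = real (P + Q + 1)"
    "l + l1 - l2 = of_int (int P)" "l - l1 + l2 = of_int (int Q)" "l1 + l2 - l = of_int (int D)"
    "l1 + l2 + l + 1 = of_int (int (D + P + Q + 1))"
    "l + j = of_int (int P - a + b)" "l - j = of_int (int Q + a - b)"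
    "l1 - (l1 - of_int a) = of_int a" "l1 + (l1 - of_int a) = of_int (int (D + P) - a)"
    "l2 - (of_int b - l2) = of_int (int (D + Q) - b)" "l2 + (of_int b - l2) = of_int b"
    by (simp_all add: l1 l2 l j field_simps)
  have k: "of_int z - real k = of_int (z - int k)" for z k by simp
  have k': "l - l2 + (l1 - of_int a) + real k = of_int (int P - a + int k)"
    "l - l1 - (of_int b - l2) + real k = of_int (int Q - b + int k)" for k
    by (simp_all add: l1 l2 l field_simps)
  have le: "real k \<le> of_int z \<longleftrightarrow> int k \<le> z" "0 \<le> real_of_int z \<longleftrightarrow> 0 \<le> z" for z k by linarith+
  have f: "ifact (int m) = fact m" for m by (simp add: ifact_def)
  have "CG l1 l2 l (l1 - of_int a) (of_int b - l2) j =
      sqrt (real (P + Q + 1) * fact P * fact Q * fact D / fact (D + P + Q + 1))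
      * sqrt (ifact (int P - a + b) * ifact (int Q + a - b) * ifact a * ifact (int (D + P) - a)
              * ifact (int (D + Q) - b) * ifact b)
      * (racah_coeff D P Q a b / (fact D * fact P * fact Q))"
    unfolding CG_def racah_sum_eq[OF a b, symmetric]
    unfolding e k k' le rfact_of_int f using j by simp
  then show ?thesis by (simp add: cg_norm_def cg_core_def mult_ac)
qed

section \<open>Spherical functions on the circle\<close>

lemma dimH_half: "dimH (real n / 2) = Suc n"
  by (simp add: dimH_def)

lemma psi_half:
  assumes "i \<le> n"
  shows "psi (real n / 2) (wt (real n / 2) i) v = complex_of_real (sqrt (real (n choose i))) * (v $ 1) ^ (n - i) * (v $ 2) ^ i"
proof -
  have e: "real n / 2 - wt (real n / 2) i = real (n - i)" "real n / 2 + wt (real n / 2) i = real i"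
    "2 * (real n / 2) = real n"
    using assms by (simp_all add: wt_def of_nat_diff)
  show ?thesis
    unfolding psi_def e floor_of_nat nat_int using assms by (simp add: binomial_symmetric[of i n])
qed

lemma m_elt_act_coords:
  "(transpose (m_elt t) *v v) $ 1 = cis (t / 2) * v $ 1"
  "(transpose (m_elt t) *v v) $ 2 = cis (- t / 2) * v $ 2"
  by (simp_all add: matrix_vector_mult_def transpose_def m_elt_def sum_2)

lemma act_m_elt_psi:
  assumes "i \<le> n"
  shows "act (m_elt t) (psi (real n / 2) (wt (real n / 2) i)) v
       = cis (- wt (real n / 2) i * t) * psi (real n / 2) (wt (real n / 2) i) v"
proof -
  have e: "cis (t / 2) ^ (n - i) * cis (- t / 2) ^ i = cis (- wt (real n / 2) i * t)"
  proof -
    have "real (n - i) * (t / 2) + real i * (- t / 2) = - wt (real n / 2) i * t"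
      using assms by (simp add: wt_def of_nat_diff field_simps)
    then show ?thesis by (simp only: Complex.DeMoivre cis_mult)
  qed
  show ?thesis
    unfolding act_def psi_half[OF assms] m_elt_act_coords power_mult_distrib e[symmetric]
    by (simp only: mult_ac)
qed

text \<open>
  The functions \<open>psi\<close> are linearly independent: on the line \<open>(1, y)\<close> they are nonzero multiples of the
  powers of \<open>y\<close>.
\<close>

lemma coords_unique:
  assumes c: "c \<in> carrier_vec (dimH (real n / 2))"
    and p: "\<And>v. p v = (\<Sum>i<dimH (real n / 2). vec_index c i * psi (real n / 2) (wt (real n / 2) i) v)"
  shows "coords (real n / 2) p = c"
  unfolding coords_def
proof (rule the_equality)
  show "c \<in> carrier_vec (dimH (real n / 2)) \<and>
      p = (\<lambda>v. \<Sum>i<dimH (real n / 2). vec_index c i * psi (real n / 2) (wt (real n / 2) i) v)"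
    using c p by auto
next
  fix c' assume c': "c' \<in> carrier_vec (dimH (real n / 2)) \<and>
      p = (\<lambda>v. \<Sum>i<dimH (real n / 2). vec_index c' i * psi (real n / 2) (wt (real n / 2) i) v)"
  have *: "p (vector [1, y]) = (\<Sum>i\<le>n. (vec_index d i * complex_of_real (sqrt (real (n choose i)))) * y ^ i)"
    if "\<And>v. p v = (\<Sum>i<dimH (real n / 2). vec_index d i * psi (real n / 2) (wt (real n / 2) i) v)" for d y
    unfolding that dimH_half lessThan_Suc_atMost by (rule sum.cong) (simp_all add: psi_half)
  have "p v = (\<Sum>i<dimH (real n / 2). vec_index c' i * psi (real n / 2) (wt (real n / 2) i) v)" for v
    using c' by metis
  from *[OF this] *[OF p] have "(\<Sum>i\<le>n. (vec_index c' i * complex_of_real (sqrt (real (n choose i)))) * y ^ i)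
    = (\<Sum>i\<le>n. (vec_index c i * complex_of_real (sqrt (real (n choose i)))) * y ^ i)" for y
    by metis
  then have "\<forall>i\<le>n. vec_index c' i * complex_of_real (sqrt (real (n choose i)))
      = vec_index c i * complex_of_real (sqrt (real (n choose i)))"
    by (subst polyfun_eq_coeffs[symmetric]) auto
  then have "vec_index c' i = vec_index c i" if "i \<le> n" for i using that by auto
  then show "c' = c"
    using c c' by (intro eq_vecI) (auto simp: dimH_half)
qed

lemma coords_act_m_elt:
  assumes "j \<le> n"
  shows "coords (real n / 2) (act (m_elt t) (psi (real n / 2) (wt (real n / 2) j)))
     = Matrix.vec (Suc n) (\<lambda>i. if i = j then cis (- wt (real n / 2) j * t) else 0)"
proof (rule coords_unique)
  fix v
  have "(\<Sum>i<Suc n. (if i = j then cis (- wt (real n / 2) j * t) else 0) * psi (real n / 2) (wt (real n / 2) i) v)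
      = (\<Sum>i<Suc n. if i = j then cis (- wt (real n / 2) j * t) * psi (real n / 2) (wt (real n / 2) j) v else 0)"
    by (rule sum.cong) auto
  then show "act (m_elt t) (psi (real n / 2) (wt (real n / 2) j)) v =
      (\<Sum>i<dimH (real n / 2). vec_index (Matrix.vec (Suc n)
         (\<lambda>i. if i = j then cis (- wt (real n / 2) j * t) else 0)) i * psi (real n / 2) (wt (real n / 2) i) v)"
    using assms by (simp add: act_m_elt_psi dimH_half del: sum.lessThan_Suc)
qed (simp add: dimH_half)

lemma T_rep_carrier [simp]: "dim_row (T_rep l k) = dimH l" "dim_col (T_rep l k) = dimH l"
  by (simp_all add: T_rep_def)

lemma T_rep_m_elt:
  assumes "i \<le> n" "j \<le> n"
  shows "T_rep (real n / 2) (m_elt t) $$ (i, j) = (if i = j then cis (- wt (real n / 2) i * t) else 0)"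
  using assms by (simp add: T_rep_def mat_of_cols_def dimH_half coords_act_m_elt nth_append del: upt_Suc)

lemma sum_div_mod:
  fixes f :: "nat \<Rightarrow> nat \<Rightarrow> 'a::comm_monoid_add"
  assumes "0 < m"
  shows "(\<Sum>r<k * m. f (r div m) (r mod m)) = (\<Sum>r1<k. \<Sum>r2<m. f r1 r2)"
proof -
  have "r1 * m + r2 < k * m" if "r1 < k" "r2 < m" for r1 r2
  proof -
    have "r1 * m + r2 < Suc r1 * m" using that by simp
    also have "\<dots> \<le> k * m" using that by (intro mult_le_mono) auto
    finally show ?thesis .
  qed
  then show ?thesis
    unfolding sum.cartesian_product
    by (intro sum.reindex_bij_witness[of _ "\<lambda>(r1, r2). r1 * m + r2" "\<lambda>r. (r div m, r mod m)"])
       (use assms in \<open>auto simp: less_mult_imp_div_less\<close>)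
qed

lemma T_outer_a_elt:
  fixes n1 n2 :: nat
  assumes l1: "l1 = real n1 / 2" and l2: "l2 = real n2 / 2"
    and r: "r < dimH l1 * dimH l2" and s: "s < dimH l1 * dimH l2"
  shows "T_outer l1 l2 (a_elt t) $$ (r, s)
    = (if r = s then cis ((wt l2 (r mod dimH l2) - wt l1 (r div dimH l2)) * t) else 0)"
proof -
  have d: "dimH l1 = Suc n1" "dimH l2 = Suc n2" unfolding l1 l2 by (rule dimH_half)+
  have b: "x div Suc n2 \<le> n1" "x mod Suc n2 \<le> n2" if "x < dimH l1 * dimH l2" for x
    using that less_mult_imp_div_less[of x "Suc n1" "Suc n2"] mod_less_divisor[of "Suc n2" x] by (auto simp: d)
  have "r = s \<longleftrightarrow> r div Suc n2 = s div Suc n2 \<and> r mod Suc n2 = s mod Suc n2"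
    by (metis div_mult_mod_eq)
  then show ?thesis
    using r s b[OF r] b[OF s] unfolding T_outer_def kronecker_def a_elt_def
    by (auto simp: d T_rep_m_elt[of _ n1] T_rep_m_elt[of _ n2] l1[symmetric] l2[symmetric])
       (auto simp: l1 l2 T_rep_m_elt cis_mult algebra_simps)
qed

lemma Phi_diag:
  fixes n1 n2 :: nat
  assumes l1: "l1 = real n1 / 2" and l2: "l2 = real n2 / 2" and q: "q < dimH l"
  shows "Phi l l1 l2 (a_elt t) $$ (q, q)
    = (\<Sum>r1\<le>n1. \<Sum>r2\<le>n2. cis ((wt l2 r2 - wt l1 r1) * t) *
          complex_of_real ((CG l1 l2 l (wt l1 r1) (wt l2 r2) (wt l q))\<^sup>2))"
proof -
  let ?m = "dimH l1 * dimH l2"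
  let ?T = "T_outer l1 l2 (a_elt t)"
  let ?c = "\<lambda>r. complex_of_real (CG l1 l2 l (wt l1 (r div dimH l2)) (wt l2 (r mod dimH l2)) (wt l q))"
  let ?w = "\<lambda>r. cis ((wt l2 (r mod dimH l2) - wt l1 (r div dimH l2)) * t)"
  have dT: "dim_row ?T = ?m" "dim_col ?T = ?m"
    by (simp_all add: T_outer_def kronecker_def)
  have adj: "mat_adjoint (beta l1 l2 l) $$ (q, r) = ?c r" if "r < ?m" for r
    using that q by (simp add: mat_adjoint_def mat_of_rows_def beta_def)
  have dadj: "dim_row (mat_adjoint (beta l1 l2 l)) = dimH l" "dim_col (mat_adjoint (beta l1 l2 l)) = ?m"
    by (simp_all add: mat_adjoint_def beta_def)
  have db: "dim_row (beta l1 l2 l) = ?m" "dim_col (beta l1 l2 l) = dimH l"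
    by (simp_all add: beta_def)
  have ib: "beta l1 l2 l $$ (r, q) = ?c r" if "r < ?m" for r
    using that q by (simp add: beta_def)
  have "Phi l l1 l2 (a_elt t) $$ (q, q)
      = (\<Sum>s<?m. (mat_adjoint (beta l1 l2 l) * ?T) $$ (q, s) * ?c s)"
    using q unfolding Phi_def
    by (subst index_mult_mat) (auto simp: scalar_prod_def dadj dT db ib lessThan_atLeast0 intro!: sum.cong)
  also have "\<dots> = (\<Sum>s<?m. ?w s * ?c s * ?c s)"
  proof (rule sum.cong[OF refl])
    fix s assume s: "s \<in> {..<?m}"
    have "(mat_adjoint (beta l1 l2 l) * ?T) $$ (q, s) = (\<Sum>r<?m. ?c r * ?T $$ (r, s))"
      using q s adj by (subst index_mult_mat)
        (auto simp: scalar_prod_def dadj dT lessThan_atLeast0 intro!: sum.cong)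
    also have "\<dots> = (\<Sum>r<?m. if r = s then ?c s * ?w s else 0)"
      using s by (intro sum.cong) (auto simp: T_outer_a_elt[OF l1 l2])
    also have "\<dots> = ?c s * ?w s" using s by simp
    finally show "(mat_adjoint (beta l1 l2 l) * ?T) $$ (q, s) * ?c s = ?w s * ?c s * ?c s" by simp
  qed
  also have "\<dots> = (\<Sum>r1<dimH l1. \<Sum>r2<dimH l2. cis ((wt l2 r2 - wt l1 r1) * t) *
      complex_of_real ((CG l1 l2 l (wt l1 r1) (wt l2 r2) (wt l q))\<^sup>2))"
    by (subst sum_div_mod[symmetric]) (simp_all add: dimH_def power2_eq_square mult.assoc)
  finally show ?thesis
    by (simp only: l1 l2 dimH_half lessThan_Suc_atMost)
qed

text \<open>
  The squared Clebsch--Gordan coefficient at \<open>j\<^sub>1 = \<ell>\<^sub>1 - x\<close> in row \<open>i\<close> and column \<open>q\<close>, where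
  \<open>2 \<ell> = n\<close> and \<open>(\<ell>\<^sub>1, \<ell>\<^sub>2) = \<zeta>(d, i - \<ell>)\<close>, hence \<open>\<ell> + \<ell>\<^sub>1 - \<ell>\<^sub>2 = i\<close>. The second index is
  determined by \<open>j\<^sub>1 + j\<^sub>2 = q - \<ell>\<close>.
\<close>

definition phi_weight :: "nat \<Rightarrow> nat \<Rightarrow> nat \<Rightarrow> nat \<Rightarrow> int \<Rightarrow> real" where
  "phi_weight n d i q x = (cg_norm d i (n - i) * cg_core d i (n - i) x (x - int i + int q))\<^sup>2"

text \<open>
  The diagonal entry is a double sum over \<open>j\<^sub>1\<close> and \<open>j\<^sub>2\<close>; for each \<open>j\<^sub>1\<close> the condition
  \<open>j\<^sub>1 + j\<^sub>2 = j\<close> leaves at most one term.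
\<close>

lemma Phi_full_entry:
  assumes i: "i \<le> n" and q: "q \<le> n"
  shows "Phi_full (real n / 2) d (a_elt t) $$ (i, q)
    = (\<Sum>x\<in>{0..int (d + i)}. complex_of_real (phi_weight n d i q x) *
         cis ((2 * of_int x - real i + real q - real d - real n / 2) * t))"
proof -
  define l where "l = real n / 2"
  define l1 where "l1 = real (d + i) / 2"
  define l2 where "l2 = real (d + (n - i)) / 2"
  have z: "zeta l d (wt l i) = (l1, l2)"
    using i by (simp add: zeta_def wt_def l_def l1_def l2_def of_nat_diff)
  have q': "q < dimH l" using q by (simp add: l_def dimH_half)
  have i': "i < dimH l" using i by (simp add: l_def dimH_half)
  have li: "l = real (i + (n - i)) / 2" using i by (simp add: l_def)
  have "Phi_full l d (a_elt t) $$ (i, q) = Phi l l1 l2 (a_elt t) $$ (q, q)"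
    using i' q' by (simp add: Phi_full_def z)
  also have "\<dots> = (\<Sum>r1\<le>d + i. \<Sum>r2\<le>d + (n - i). cis ((wt l2 r2 - wt l1 r1) * t) *
          complex_of_real ((CG l1 l2 l (wt l1 r1) (wt l2 r2) (wt l q))\<^sup>2))"
    by (rule Phi_diag[OF l1_def l2_def q'])
  also have "\<dots> = (\<Sum>x\<in>{0..int (d + i)}. \<Sum>b\<in>{0..int (d + (n - i))}.
        if b = x - int i + int q then complex_of_real (phi_weight n d i q x) *
         cis ((2 * of_int x - real i + real q - real d - real n / 2) * t) else 0)"
  proof (rule sum.reindex_bij_witness[of _ "\<lambda>x. nat (int (d + i) - x)" "\<lambda>r. int (d + i) - int r"]; (auto; fail)?)
    fix r1 assume r1: "r1 \<in> {..d + i}"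
    define x where "x = int (d + i) - int r1"
    have x: "0 \<le> x" "x \<le> int (d + i)" using r1 by (auto simp: x_def)
    have w1: "wt l1 r1 = l1 - of_int x" by (simp add: wt_def l1_def x_def field_simps)
    have "(\<Sum>b\<in>{0..int (d + (n - i))}.
        if b = x - int i + int q then complex_of_real (phi_weight n d i q x) *
         cis ((2 * of_int x - real i + real q - real d - real n / 2) * t) else 0)
      = (\<Sum>r2\<le>d + (n - i). cis ((wt l2 r2 - wt l1 r1) * t) *
          complex_of_real ((CG l1 l2 l (wt l1 r1) (wt l2 r2) (wt l q))\<^sup>2))"
    proof (rule sum.reindex_bij_witness[of _ int nat]; (auto; fail)?)
      fix b assume b: "b \<in> {0..int (d + (n - i))}"
      have w2: "wt l2 (nat b) = of_int b - l2" using b by (simp add: wt_def)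
      show "cis ((wt l2 (nat b) - wt l1 r1) * t) *
          complex_of_real ((CG l1 l2 l (wt l1 r1) (wt l2 (nat b)) (wt l q))\<^sup>2)
        = (if b = x - int i + int q then complex_of_real (phi_weight n d i q x) *
         cis ((2 * of_int x - real i + real q - real d - real n / 2) * t) else 0)"
      proof (cases "b = x - int i + int q")
        case True
        have "CG l1 l2 l (wt l1 r1) (wt l2 (nat b)) (wt l q) = cg_norm d i (n - i) * cg_core d i (n - i) x b"
          unfolding w1 w2 using b x i
          by (intro CG_eq_cg_core) (auto simp: l1_def l2_def li wt_def True of_nat_diff add_divide_distrib diff_divide_distrib)
        moreover have "(wt l2 (nat b) - wt l1 r1) = 2 * of_int x - real i + real q - real d - real n / 2"
          unfolding w1 w2 using i by (simp add: True l1_def l2_def of_nat_diff field_simps)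
        ultimately show ?thesis using True by (simp add: phi_weight_def)
      next
        case False
        have "wt l1 r1 + wt l2 (nat b) \<noteq> wt l q"
        proof
          assume "wt l1 r1 + wt l2 (nat b) = wt l q"
          then have "real_of_int b = of_int (x - int i + int q)"
            unfolding w1 w2 using i by (simp add: l_def wt_def l1_def l2_def of_nat_diff field_simps)
          with False show False by linarith
        qed
        then show ?thesis using False by (simp add: CG_def)
      qed
    qed
    then show "(\<Sum>b\<in>{0..int (d + (n - i))}.
        if b = int (d + i) - int r1 - int i + int q then complex_of_real (phi_weight n d i q (int (d + i) - int r1)) *
         cis ((2 * of_int (int (d + i) - int r1) - real i + real q - real d - real n / 2) * t) else 0)
      = (\<Sum>r2\<le>d + (n - i). cis ((wt l2 r2 - wt l1 r1) * t) *
          complex_of_real ((CG l1 l2 l (wt l1 r1) (wt l2 r2) (wt l q))\<^sup>2))"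
      by (simp only: x_def)
  qed
  also have "\<dots> = (\<Sum>x\<in>{0..int (d + i)}. complex_of_real (phi_weight n d i q x) *
         cis ((2 * of_int x - real i + real q - real d - real n / 2) * t))"
  proof (rule sum.cong[OF refl])
    fix x
    have "phi_weight n d i q x = 0" if "x - int i + int q \<notin> {0..int (d + (n - i))}"
      using that by (auto simp: phi_weight_def intro!: cg_core_outside)
    then show "(\<Sum>b\<in>{0..int (d + (n - i))}.
        if b = x - int i + int q then complex_of_real (phi_weight n d i q x) *
         cis ((2 * of_int x - real i + real q - real d - real n / 2) * t) else 0)
      = complex_of_real (phi_weight n d i q x) *
         cis ((2 * of_int x - real i + real q - real d - real n / 2) * t)"
      by (subst sum.delta) auto
  qed
  finally show ?thesis by (simp add: l_def)
qed

section \<open>Invariant integration on the circle\<close>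

text \<open>The character \<open>a\<^sub>t \<mapsto> exp (i k t / 2)\<close> of the circle group.\<close>

definition circle_char :: "int \<Rightarrow> cmat2 \<times> cmat2 \<Rightarrow> complex" where
  "circle_char k a = (fst a $ 1 $ 1) powi k"

lemma m_elt_nth:
  "m_elt t $ 1 $ 1 = cis (t / 2)" "m_elt t $ 1 $ 2 = 0"
  "m_elt t $ 2 $ 1 = 0" "m_elt t $ 2 $ 2 = cis (- t / 2)"
  by (simp_all add: m_elt_def)

lemma m_elt_mult: "m_elt s ** m_elt t = m_elt (s + t)"
  by (simp add: vec_eq_iff forall_2 matrix_matrix_mult_def sum_2 m_elt_nth cis_mult add_divide_distrib diff_divide_distrib)

lemma a_elt_mult: "mult_U (a_elt s) (a_elt t) = a_elt (s + t)"
  by (simp add: mult_U_def a_elt_def m_elt_mult)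

lemma a_elt_eq_iff: "a_elt s = a_elt t \<longleftrightarrow> (\<exists>k::int. s = t + 4 * pi * of_int k)"
proof
  assume "a_elt s = a_elt t"
  then have "cis (s / 2) = cis (t / 2)" by (metis a_elt_def fst_conv m_elt_nth(1))
  then have "sin (s / 2) = sin (t / 2) \<and> cos (s / 2) = cos (t / 2)" by (simp add: complex_eq_iff)
  then obtain n :: int where "s / 2 = t / 2 + 2 * pi * of_int n" by (auto simp: sin_cos_eq_iff)
  then show "\<exists>k::int. s = t + 4 * pi * of_int k" by (intro exI[of _ n]) (simp add: field_simps)
next
  assume "\<exists>k::int. s = t + 4 * pi * of_int k"
  then obtain k :: int where k: "s = t + 4 * pi * of_int k" by blast
  have 1: "cis (s / 2) = cis (t / 2)"
  proof -
    have "s / 2 = t / 2 + 2 * pi * of_int k" using k by simp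
    then have "cis (s / 2) = cis (t / 2) * cis (2 * pi * of_int k)" by (simp only: cis_mult)
    then show ?thesis by simp
  qed
  have 2: "cis (- s / 2) = cis (- t / 2)" using arg_cong[OF 1, of cnj] by (simp add: cis_cnj)
  show "a_elt s = a_elt t"
    using 1 2 by (simp add: a_elt_def vec_eq_iff forall_2 m_elt_nth)
qed

lemma a_elt_representative: "\<exists>s\<in>{0..<4 * pi}. a_elt t = a_elt s"
proof -
  define k where "k = \<lfloor>t / (4 * pi)\<rfloor>"
  have "of_int k \<le> t / (4 * pi)" "t / (4 * pi) < of_int k + 1" by (simp_all add: k_def)
  then have "of_int k * (4 * pi) \<le> t" "t < (of_int k + 1) * (4 * pi)"
    by (simp_all add: pos_le_divide_eq pos_divide_less_eq)
  then have "t - 4 * pi * of_int k \<in> {0..<4 * pi}" by (simp add: algebra_simps)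
  moreover have "a_elt t = a_elt (t - 4 * pi * of_int k)"
    unfolding a_elt_eq_iff by (rule exI[of _ k]) simp
  ultimately show ?thesis by blast
qed

lemma a_elt_in_A_star [simp]: "a_elt t \<in> A_star"
  using a_elt_representative[of t] by (auto simp: A_star_def)

lemma A_starE:
  assumes "a \<in> A_star" obtains t where "a = a_elt t"
  using assms by (auto simp: A_star_def)

lemma A_star_eq_range: "A_star = range a_elt"
  by (auto elim: A_starE)

lemma angle_a_elt:
  assumes "t \<in> {0..<4 * pi}" shows "angle (a_elt t) = t"
  unfolding angle_def
proof (rule the_equality)
  fix s assume s: "s \<in> {0..<4 * pi} \<and> a_elt t = a_elt s"
  then obtain k :: int where k: "t = s + 4 * pi * of_int k" by (auto simp: a_elt_eq_iff)
  have "\<bar>4 * pi * of_int k\<bar> < 4 * pi * 1" using s assms k by auto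
  then have "\<bar>of_int k :: real\<bar> < 1" by (simp add: abs_mult)
  then have "k = 0" by linarith
  then show "s = t" using k by simp
qed (use assms in simp)

lemma D_star_a_elt: "D_star (a_elt t) = (sin t)\<^sup>2"
proof -
  obtain s where s: "s \<in> {0..<4 * pi}" "a_elt t = a_elt s" using a_elt_representative by blast
  then obtain k :: int where "t = s + 4 * pi * of_int k" by (auto simp: a_elt_eq_iff)
  then have "t = s + 2 * pi * of_int (2 * k)" by simp
  then have "sin t = sin s \<and> cos t = cos s" unfolding sin_cos_eq_iff by blast
  then show ?thesis using s by (simp add: D_star_def angle_a_elt)
qed

lemma circle_char_a_elt: "circle_char k (a_elt t) = cis (of_int k * t / 2)"
  by (simp add: circle_char_def a_elt_def m_elt_nth cis_power_int)

lemma D_star_eq_circle_char: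
  assumes "a \<in> A_star"
  shows "complex_of_real (D_star a) = 1 / 2 - (circle_char 4 a + circle_char (- 4) a) / 4"
proof -
  obtain t where a: "a = a_elt t" using assms by (rule A_starE)
  have "circle_char 4 a + circle_char (- 4) a = complex_of_real (2 * cos (2 * t))"
    unfolding a circle_char_a_elt by (simp add: complex_eq_iff)
  also have "2 * cos (2 * t) = 2 - 4 * (sin t)\<^sup>2" by (simp add: cos_double_sin)
  finally show ?thesis unfolding a D_star_a_elt by (simp add: field_simps)
qed

lemma D_star_nonneg: "0 \<le> D_star a"
  by (simp add: D_star_def)

lemma circle_char_mult:
  assumes "a \<in> A_star" shows "circle_char j a * circle_char k a = circle_char (j + k) a"
proof -
  obtain t where a: "a = a_elt t" using assms by (rule A_starE)
  show ?thesis unfolding a circle_char_a_elt cis_mult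
    by (rule arg_cong[of _ _ cis]) (simp add: field_simps)
qed

lemma circle_char_translate:
  assumes "a \<in> A_star"
  shows "circle_char k (mult_U (a_elt s) a) = cis (of_int k * s / 2) * circle_char k a"
proof -
  obtain t where a: "a = a_elt t" using assms by (rule A_starE)
  show ?thesis unfolding a a_elt_mult circle_char_a_elt cis_mult
    by (rule arg_cong[of _ _ cis]) (simp add: field_simps)
qed

lemma continuous_on_m_elt: "continuous_on S m_elt"
proof -
  have m: "m_elt = (\<lambda>t. \<chi> i j. if i = j then (if i = 1 then cis (t / 2) else cis (- t / 2)) else 0)"
    by (rule ext) (simp add: vec_eq_iff forall_2 m_elt_nth)
  have "continuous_on S (\<lambda>t. if i = j then (if i = (1::2) then cis (t / 2) else cis (- t / 2)) else 0)"
    for i j :: 2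
    by (cases "i = j"; cases "i = 1") (auto intro!: continuous_intros)
  then show ?thesis unfolding m by (intro continuous_on_vec_lambda)
qed

lemma continuous_on_a_elt: "continuous_on S a_elt"
proof -
  have "continuous_on S (\<lambda>t. m_elt (- t))"
    by (rule continuous_on_compose2[OF continuous_on_m_elt[of UNIV]]) (auto intro!: continuous_intros)
  then show ?thesis
    unfolding a_elt_def by (intro continuous_on_Pair continuous_on_m_elt)
qed

lemma continuous_on_circle_char: "continuous_on A_star (circle_char k)"
  unfolding circle_char_def
  by (intro continuous_intros) (auto elim!: A_starE simp: a_elt_def m_elt_nth)

lemma continuous_on_D_star: "continuous_on A_star D_star"
proof -
  have "continuous_on A_star (\<lambda>a. Re (1 / 2 - (circle_char 4 a + circle_char (- 4) a) / 4))"
    by (intro continuous_intros continuous_on_circle_char) auto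
  moreover have "Re (1 / 2 - (circle_char 4 a + circle_char (- 4) a) / 4) = D_star a" if "a \<in> A_star" for a
    using D_star_eq_circle_char[OF that] by (metis Re_complex_of_real)
  ultimately show ?thesis by (simp cong: continuous_on_cong_simp)
qed

lemma compact_A_star: "compact A_star"
proof -
  have "A_star \<subseteq> a_elt ` {0..4 * pi}" by (auto simp: A_star_def)
  then have "a_elt ` {0..4 * pi} = A_star" by (auto simp: A_star_eq_range)
  moreover have "compact (a_elt ` {0..4 * pi})"
    by (intro compact_continuous_image continuous_on_a_elt) simp
  ultimately show ?thesis by simp
qed

lemma continuous_on_mult_U: "continuous_on S (mult_U g)"
  unfolding mult_U_def matrix_matrix_mult_def
  by (intro continuous_intros)

locale haar_circle =
  fixes \<mu> :: "(cmat2 \<times> cmat2) measure"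
  assumes haar: "haar_measure_A_star \<mu>"
begin

sublocale finite_measure \<mu>
  using haar by (simp add: haar_measure_A_star_def)

lemma sets_mu: "sets \<mu> = sets (restrict_space borel A_star)"
  using haar by (simp add: haar_measure_A_star_def)

lemma space_mu [simp]: "space \<mu> = A_star"
  using sets_eq_imp_space_eq[OF sets_mu] by (simp add: space_restrict_space)

lemma measurable_continuous_on:
  fixes f :: "cmat2 \<times> cmat2 \<Rightarrow> 'b::topological_space"
  assumes "continuous_on A_star f" shows "f \<in> borel_measurable \<mu>"
  using borel_measurable_continuous_on_restrict[OF assms] measurable_cong_sets[OF sets_mu refl] by blast

lemma measurable_translate: "mult_U (a_elt s) \<in> measurable \<mu> \<mu>"
proof -
  have "mult_U (a_elt s) \<in> borel_measurable \<mu>"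
    by (rule measurable_continuous_on[OF continuous_on_mult_U])
  moreover have "mult_U (a_elt s) a \<in> A_star" if "a \<in> A_star" for a
    using that by (auto elim!: A_starE simp: a_elt_mult)
  ultimately have "mult_U (a_elt s) \<in> measurable \<mu> (restrict_space borel A_star)"
    by (intro measurable_restrict_space2) auto
  then show ?thesis using measurable_cong_sets[OF refl sets_mu] by blast
qed

lemma distr_translate: "distr \<mu> \<mu> (mult_U (a_elt s)) = \<mu>"
  using haar by (simp add: haar_measure_A_star_def)

lemma integral_translate:
  fixes f :: "cmat2 \<times> cmat2 \<Rightarrow> complex"
  assumes "f \<in> borel_measurable \<mu>"
  shows "(LINT a|\<mu>. f (mult_U (a_elt s) a)) = (LINT a|\<mu>. f a)"
  using integral_distr[OF measurable_translate assms, of s] by (simp add: distr_translate)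

lemma AE_translate:
  assumes "AE a in \<mu>. P a" shows "AE a in \<mu>. P (mult_U (a_elt s) a)"
  by (rule AE_distrD[OF measurable_translate]) (unfold distr_translate, rule assms)

lemma measure_space_pos: "0 < measure \<mu> A_star"
proof -
  have "emeasure \<mu> A_star \<noteq> 0" using haar by (simp add: haar_measure_A_star_def)
  then show ?thesis by (simp add: emeasure_eq_measure zero_less_measure_iff)
qed

lemma integrable_continuous_on:
  fixes f :: "cmat2 \<times> cmat2 \<Rightarrow> 'b::{banach,second_countable_topology}"
  assumes f: "continuous_on A_star f" shows "integrable \<mu> f"
proof -
  have "bounded (f ` A_star)"
    by (intro compact_imp_bounded compact_continuous_image f compact_A_star)
  then obtain B where "\<And>a. a \<in> A_star \<Longrightarrow> norm (f a) \<le> B" by (auto simp: bounded_iff)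
  then show ?thesis
    by (intro integrable_const_bound[where B = B] measurable_continuous_on f AE_I2) auto
qed

text \<open>
  Translation by a group element at which a nontrivial character is \<open>-1\<close> changes the sign of the integral.
\<close>

lemma integral_circle_char: "(LINT a|\<mu>. circle_char k a) = (if k = 0 then measure \<mu> A_star else 0)"
proof (cases "k = 0")
  case True
  then show ?thesis by (simp add: circle_char_def scaleR_conv_of_real)
next
  case False
  define s where "s = 2 * pi / of_int k"
  have s: "of_int k * s / 2 = pi" using False by (simp add: s_def)
  have "(LINT a|\<mu>. circle_char k a) = (LINT a|\<mu>. circle_char k (mult_U (a_elt s) a))"
    by (rule integral_translate[symmetric]) (intro measurable_continuous_on continuous_on_circle_char)
  also have "\<dots> = (LINT a|\<mu>. - circle_char k a)"
    by (intro Bochner_Integration.integral_cong) (auto simp: circle_char_translate s)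
  finally show ?thesis using False by simp
qed

lemma integral_circle_char_weight:
  "(LINT a|\<mu>. circle_char k a * complex_of_real (D_star a)) =
     complex_of_real (measure \<mu> A_star / 4) *
       (2 * of_bool (k = 0) - of_bool (k = - 4) - of_bool (k = 4))"
proof -
  have i: "integrable \<mu> (circle_char j)" for j
    by (intro integrable_continuous_on continuous_on_circle_char)
  have "(LINT a|\<mu>. circle_char k a * complex_of_real (D_star a))
      = (LINT a|\<mu>. circle_char k a / 2 - (circle_char (k + 4) a / 4 + circle_char (k - 4) a / 4))"
  proof (rule Bochner_Integration.integral_cong[OF refl])
    fix a assume "a \<in> space \<mu>"
    then have a: "a \<in> A_star" by simp
    show "circle_char k a * complex_of_real (D_star a)
        = circle_char k a / 2 - (circle_char (k + 4) a / 4 + circle_char (k - 4) a / 4)"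
      using circle_char_mult[OF a, of k 4] circle_char_mult[OF a, of k "- 4"]
      by (simp add: D_star_eq_circle_char[OF a] algebra_simps)
  qed
  also have "\<dots> = (LINT a|\<mu>. circle_char k a) / 2
      - ((LINT a|\<mu>. circle_char (k + 4) a) / 4 + (LINT a|\<mu>. circle_char (k - 4) a) / 4)"
    by (simp add: i)
  finally show ?thesis
    by (auto simp: integral_circle_char eq_neg_iff_add_eq_0)
qed

text \<open>
  The zero set of the weight has infinitely many pairwise disjoint translates of equal measure, and
  the measure is finite.
\<close>

lemma AE_D_star_nonzero: "AE a in \<mu>. D_star a \<noteq> 0"
proof -
  define Z where "Z n = {a \<in> A_star. D_star (mult_U (a_elt (1 / real (Suc n))) a) = 0}" for n
  have Dm: "D_star \<in> borel_measurable \<mu>"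
    by (intro measurable_continuous_on continuous_on_D_star)
  define Z0 where "Z0 = {a \<in> space \<mu>. D_star a = 0}"
  have Z0: "Z0 \<in> sets \<mu>" unfolding Z0_def using Dm by measurable
  have Z_eq: "Z n = mult_U (a_elt (1 / real (Suc n))) -` Z0 \<inter> space \<mu>" for n
    using measurable_space[OF measurable_translate] by (auto simp: Z_def Z0_def)
  have Zs: "Z n \<in> sets \<mu>" for n
    unfolding Z_eq by (rule measurable_sets[OF measurable_translate Z0])
  have Zm: "measure \<mu> (Z n) = measure \<mu> Z0" for n
    using measure_distr[OF measurable_translate Z0] by (simp add: Z_eq distr_translate)
  have "disjoint_family Z"
  unfolding disjoint_family_on_def
  proof (intro ballI impI)
    fix m n :: nat assume "m \<noteq> n"
    show "Z m \<inter> Z n = {}"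
    proof (rule ccontr)
      assume "Z m \<inter> Z n \<noteq> {}"
      then obtain t where t: "sin (1 / real (Suc m) + t) = 0" "sin (1 / real (Suc n) + t) = 0"
        by (auto simp: Z_def a_elt_mult D_star_a_elt elim!: A_starE)
      let ?d = "1 / real (Suc m) - 1 / real (Suc n)"
      have "sin ((1 / real (Suc m) + t) - (1 / real (Suc n) + t)) = 0"
        unfolding sin_diff using t by simp
      then have "sin ?d = 0" by simp
      moreover have "\<bar>?d\<bar> < 1"
      proof -
        have "0 < 1 / real (Suc k)" "1 / real (Suc k) \<le> 1" for k by simp_all
        from this[of m] this[of n] show ?thesis by linarith
      qed
      moreover have "1 < pi" using pi_gt3 by simp
      ultimately have "?d = 0"
        using sin_eq_0_pi[of ?d] by linarith
      with \<open>m \<noteq> n\<close> show False by simp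
    qed
  qed
  then have "(\<lambda>n. measure \<mu> (Z n)) sums measure \<mu> (\<Union>n. Z n)"
    using Zs by (intro finite_measure_UNION) auto
  then have "(\<lambda>n::nat. measure \<mu> Z0) \<longlonglongrightarrow> 0"
    unfolding Zm by (intro summable_LIMSEQ_zero) (rule sums_summable)
  then have "measure \<mu> Z0 = 0" by (simp add: LIMSEQ_const_iff)
  then have "Z0 \<in> null_sets \<mu>" using Z0 by (simp add: null_sets_def emeasure_eq_measure)
  then show ?thesis
    by (rule AE_I') (auto simp: Z0_def)
qed

text \<open>
  Almost every point is a common zero of all translates of \<open>f\<close> by rational angles. One such point
  makes \<open>f\<close> vanish on a dense subset of the circle.
\<close>

lemma AE_zero_imp_zero:
  fixes f :: "cmat2 \<times> cmat2 \<Rightarrow> complex"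
  assumes f: "continuous_on A_star f" and ae: "AE a in \<mu>. f a = 0" and a: "a \<in> A_star"
  shows "f a = 0"
proof -
  have "AE b in \<mu>. \<forall>s\<in>\<rat>. f (mult_U (a_elt s) b) = 0"
    using AE_translate[OF ae] by (subst AE_ball_countable[OF countable_rat]) auto
  then obtain N where N: "{b \<in> space \<mu>. \<not> (\<forall>s\<in>\<rat>. f (mult_U (a_elt s) b) = 0)} \<subseteq> N"
    "emeasure \<mu> N = 0" "N \<in> sets \<mu>" by (rule AE_E)
  have "\<not> A_star \<subseteq> N"
  proof
    assume "A_star \<subseteq> N"
    then have "measure \<mu> A_star \<le> measure \<mu> N" by (intro finite_measure_mono N(3))
    then show False using N(2) measure_space_pos by (simp add: measure_def)
  qed
  then obtain b where b: "b \<in> A_star" "\<forall>s\<in>\<rat>. f (mult_U (a_elt s) b) = 0"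
    using N(1) by auto
  then obtain u where u: "b = a_elt u" by (auto elim: A_starE)
  obtain t where t: "a = a_elt t" using a by (rule A_starE)
  define g where "g s = f (a_elt (s + u))" for s
  have "continuous_on UNIV g"
    unfolding g_def
    by (rule continuous_on_compose2[OF f, of _ "\<lambda>s. a_elt (s + u)"])
       (auto intro!: continuous_on_compose2[OF continuous_on_a_elt[of UNIV]] continuous_intros)
  then have "g s = 0" for s
    using continuous_constant_on_closure[of \<rat> g 0 s] b u
    by (auto simp: Rats_closure_real g_def a_elt_mult intro: continuous_on_subset)
  from this[of "t - u"] show ?thesis by (simp add: g_def t)
qed

end

section \<open>The matrix-valued inner product\<close>

lemma mat_adjoint_index:
  fixes A :: "complex mat"
  assumes "i < dim_col A" "j < dim_row A"
  shows "mat_adjoint A $$ (i, j) = cnj (A $$ (j, i))"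
  using assms by (simp add: mat_adjoint_def mat_of_rows_def)

lemma mat_adjoint_dim [simp]:
  "dim_row (mat_adjoint A) = dim_col A" "dim_col (mat_adjoint A) = dim_row A"
  by (simp_all add: mat_adjoint_def)

lemma index_mult_mat_sum:
  assumes "A \<in> carrier_mat n m" "B \<in> carrier_mat m k" "i < n" "j < k"
  shows "(A * B) $$ (i, j) = (\<Sum>r<m. A $$ (i, r) * B $$ (r, j))"
  using assms by (auto simp: scalar_prod_def lessThan_atLeast0 intro!: sum.cong)

context haar_circle
begin

text \<open>Scalar versions of the function space and of the pairing, without the factor \<open>2 / \<pi>\<close>.\<close>

definition square_integrable :: "(cmat2 \<times> cmat2 \<Rightarrow> complex) \<Rightarrow> bool" where
  "square_integrable f \<longleftrightarrow>
     f \<in> borel_measurable \<mu> \<and> integrable \<mu> (\<lambda>a. (cmod (f a))\<^sup>2 * D_star a)"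

definition weighted_ip :: "(cmat2 \<times> cmat2 \<Rightarrow> complex) \<Rightarrow> (cmat2 \<times> cmat2 \<Rightarrow> complex) \<Rightarrow> complex" where
  "weighted_ip f g = (LINT a|\<mu>. f a * cnj (g a) * complex_of_real (D_star a))"

lemma D_star_measurable [measurable]: "D_star \<in> borel_measurable \<mu>"
  by (intro measurable_continuous_on continuous_on_D_star)

lemma cnj_measurable [measurable]: "cnj \<in> borel_measurable borel"
  by (intro borel_measurable_continuous_onI continuous_intros)

lemma D_star_measurable_complex [measurable]: "(\<lambda>a. complex_of_real (D_star a)) \<in> borel_measurable \<mu>"
  by (intro measurable_continuous_on continuous_intros continuous_on_D_star)

lemma square_integrable_cong:
  assumes "\<And>a. a \<in> A_star \<Longrightarrow> f a = g a"
  shows "square_integrable f \<longleftrightarrow> square_integrable g"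
  unfolding square_integrable_def
  using assms by (intro conj_cong measurable_cong Bochner_Integration.integrable_cong) auto

lemma weighted_ip_cong:
  assumes "\<And>a. a \<in> A_star \<Longrightarrow> f a = f' a" "\<And>a. a \<in> A_star \<Longrightarrow> g a = g' a"
  shows "weighted_ip f g = weighted_ip f' g'"
  unfolding weighted_ip_def using assms by (intro Bochner_Integration.integral_cong) auto

lemma square_integrable_add:
  assumes "square_integrable f" "square_integrable g"
  shows "square_integrable (\<lambda>a. f a + g a)"
proof -
  have [measurable]: "f \<in> borel_measurable \<mu>" "g \<in> borel_measurable \<mu>"
    using assms by (auto simp: square_integrable_def)
  have "integrable \<mu> (\<lambda>a. 2 * ((cmod (f a))\<^sup>2 * D_star a) + 2 * ((cmod (g a))\<^sup>2 * D_star a))"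
    using assms by (auto simp: square_integrable_def)
  then have "integrable \<mu> (\<lambda>a. (cmod (f a + g a))\<^sup>2 * D_star a)"
  proof (rule Bochner_Integration.integrable_bound)
    show "AE a in \<mu>. norm ((cmod (f a + g a))\<^sup>2 * D_star a)
        \<le> norm (2 * ((cmod (f a))\<^sup>2 * D_star a) + 2 * ((cmod (g a))\<^sup>2 * D_star a))"
    proof (rule AE_I2)
      fix a
      have "(cmod (f a + g a))\<^sup>2 \<le> (cmod (f a) + cmod (g a))\<^sup>2"
        by (intro power_mono norm_triangle_ineq) simp
      also have "\<dots> \<le> 2 * (cmod (f a))\<^sup>2 + 2 * (cmod (g a))\<^sup>2"
        using sum_squares_bound[of "cmod (f a)" "cmod (g a)"] by (simp add: power2_sum)
      finally have "(cmod (f a + g a))\<^sup>2 * D_star a \<le> (2 * (cmod (f a))\<^sup>2 + 2 * (cmod (g a))\<^sup>2) * D_star a"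
        by (rule mult_right_mono) (rule D_star_nonneg)
      then show "norm ((cmod (f a + g a))\<^sup>2 * D_star a)
        \<le> norm (2 * ((cmod (f a))\<^sup>2 * D_star a) + 2 * ((cmod (g a))\<^sup>2 * D_star a))"
        by (simp add: D_star_nonneg algebra_simps)
    qed
  qed measurable
  then show ?thesis by (simp add: square_integrable_def)
qed

lemma square_integrable_cmult:
  assumes "square_integrable f" shows "square_integrable (\<lambda>a. c * f a)"
proof -
  have "integrable \<mu> (\<lambda>a. (cmod c)\<^sup>2 * ((cmod (f a))\<^sup>2 * D_star a))"
    using assms by (auto simp: square_integrable_def)
  then show ?thesis
    using assms
    by (auto simp: square_integrable_def norm_mult power_mult_distrib mult.assoc intro: borel_measurable_times)
qed

lemma square_integrable_sum:
  assumes "\<And>i. i \<in> I \<Longrightarrow> square_integrable (f i)"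
  shows "square_integrable (\<lambda>a. \<Sum>i\<in>I. f i a)"
  using assms
proof (induction I rule: infinite_finite_induct)
  case (insert x F)
  then show ?case using square_integrable_add[of "f x" "\<lambda>a. \<Sum>i\<in>F. f i a"] by simp
qed (simp_all add: square_integrable_def)

lemma square_integrable_continuous_on:
  assumes "continuous_on A_star f" shows "square_integrable f"
  unfolding square_integrable_def using assms
  by (auto intro!: measurable_continuous_on integrable_continuous_on continuous_intros continuous_on_D_star)

lemma integrable_weighted_product:
  assumes "square_integrable f" "square_integrable g"
  shows "integrable \<mu> (\<lambda>a. f a * cnj (g a) * complex_of_real (D_star a))"
proof -
  have [measurable]: "f \<in> borel_measurable \<mu>" "g \<in> borel_measurable \<mu>"
    using assms by (auto simp: square_integrable_def)
  have "integrable \<mu> (\<lambda>a. (cmod (f a))\<^sup>2 * D_star a + (cmod (g a))\<^sup>2 * D_star a)"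
    using assms by (auto simp: square_integrable_def)
  then show ?thesis
  proof (rule Bochner_Integration.integrable_bound)
    show "AE a in \<mu>. norm (f a * cnj (g a) * complex_of_real (D_star a))
        \<le> norm ((cmod (f a))\<^sup>2 * D_star a + (cmod (g a))\<^sup>2 * D_star a)"
    proof (rule AE_I2)
      fix a
      have "cmod (f a) * cmod (g a) \<le> (cmod (f a))\<^sup>2 + (cmod (g a))\<^sup>2"
        using sum_squares_bound[of "cmod (f a)" "cmod (g a)"]
          mult_nonneg_nonneg[OF norm_ge_zero[of "f a"] norm_ge_zero[of "g a"]] by linarith
      then have "cmod (f a) * cmod (g a) * D_star a \<le> ((cmod (f a))\<^sup>2 + (cmod (g a))\<^sup>2) * D_star a"
        by (rule mult_right_mono) (rule D_star_nonneg)
      then show "norm (f a * cnj (g a) * complex_of_real (D_star a))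
        \<le> norm ((cmod (f a))\<^sup>2 * D_star a + (cmod (g a))\<^sup>2 * D_star a)"
        by (simp add: norm_mult D_star_nonneg algebra_simps)
    qed
  qed measurable
qed

lemma weighted_ip_add:
  assumes "square_integrable f" "square_integrable f'" "square_integrable g"
  shows "weighted_ip (\<lambda>a. f a + f' a) g = weighted_ip f g + weighted_ip f' g"
  using integrable_weighted_product[OF assms(1,3)] integrable_weighted_product[OF assms(2,3)]
  by (simp add: weighted_ip_def distrib_right)

lemma weighted_ip_cmult: "weighted_ip (\<lambda>a. c * f a) g = c * weighted_ip f g"
  by (simp add: weighted_ip_def mult.assoc)

lemma weighted_ip_cnj: "cnj (weighted_ip f g) = weighted_ip g f"
  unfolding weighted_ip_def
  by (subst Bochner_Integration.integral_cnj[symmetric]) (rule Bochner_Integration.integral_cong; simp)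

lemma weighted_ip_sum:
  assumes "\<And>i. i \<in> I \<Longrightarrow> square_integrable (f i)" "square_integrable g"
  shows "weighted_ip (\<lambda>a. \<Sum>i\<in>I. f i a) g = (\<Sum>i\<in>I. weighted_ip (f i) g)"
  using assms
proof (induction I rule: infinite_finite_induct)
  case (insert x F)
  then show ?case
    using weighted_ip_add[of "f x" "\<lambda>a. \<Sum>i\<in>F. f i a" g] by (simp add: square_integrable_sum)
qed (simp_all add: weighted_ip_def)

lemma weighted_ip_sum_right:
  assumes "\<And>i. i \<in> I \<Longrightarrow> square_integrable (f i)" "square_integrable g"
  shows "weighted_ip g (\<lambda>a. \<Sum>i\<in>I. f i a) = (\<Sum>i\<in>I. weighted_ip g (f i))"
proof -
  have "cnj (weighted_ip (\<lambda>a. \<Sum>i\<in>I. f i a) g) = (\<Sum>i\<in>I. cnj (weighted_ip (f i) g))"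
    using weighted_ip_sum[of I f g] assms by simp
  then show ?thesis unfolding weighted_ip_cnj .
qed

lemma weighted_ip_cmult_right: "weighted_ip g (\<lambda>a. c * f a) = cnj c * weighted_ip g f"
  using arg_cong[OF weighted_ip_cmult[of c f g], of cnj] by (simp add: weighted_ip_cnj)

lemma weighted_ip_self:
  "weighted_ip f f = complex_of_real (LINT a|\<mu>. (cmod (f a))\<^sup>2 * D_star a)"
  unfolding weighted_ip_def integral_complex_of_real[symmetric]
  by (rule Bochner_Integration.integral_cong) (simp_all only: of_real_mult complex_norm_square)

lemma weighted_ip_self_nonneg: "0 \<le> weighted_ip f f"
  unfolding weighted_ip_self by (simp add: D_star_nonneg less_eq_complex_def)

lemma weighted_ip_definite:
  assumes f: "square_integrable f" and "weighted_ip f f = 0"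
  shows "AE a in \<mu>. f a = 0"
proof -
  have "(LINT a|\<mu>. (cmod (f a))\<^sup>2 * D_star a) = 0"
    using assms(2) unfolding weighted_ip_self by (simp only: of_real_eq_0_iff)
  then have "AE a in \<mu>. (cmod (f a))\<^sup>2 * D_star a = 0"
    using f by (subst (asm) integral_nonneg_eq_0_iff_AE) (auto simp: square_integrable_def D_star_nonneg)
  with AE_D_star_nonzero show ?thesis by eventually_elim simp
qed

lemma L2_funs_iff:
  "\<Phi> \<in> L2_funs \<mu> l \<longleftrightarrow> (\<forall>a\<in>A_star. \<Phi> a \<in> carrier_mat (dimH l) (dimH l)) \<and>
     (\<forall>i<dimH l. \<forall>j<dimH l. square_integrable (\<lambda>a. \<Phi> a $$ (i, j)))"
  by (auto simp: L2_funs_def square_integrable_def D_star_nonneg)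

lemma cont_funs_subset_L2: "cont_funs l \<subseteq> L2_funs \<mu> l"
  unfolding cont_funs_def L2_funs_iff subset_iff mem_Collect_eq
  by (intro allI impI conjI square_integrable_continuous_on) simp_all

lemma pairing_entry:
  assumes \<Phi>: "\<Phi> \<in> L2_funs \<mu> l" and \<Psi>: "\<Psi> \<in> L2_funs \<mu> l" and ij: "i < dimH l" "j < dimH l"
  shows "pairing \<mu> l \<Phi> \<Psi> $$ (i, j)
    = complex_of_real (2 / pi) * (\<Sum>k<dimH l. weighted_ip (\<lambda>a. \<Phi> a $$ (i, k)) (\<lambda>a. \<Psi> a $$ (j, k)))"
proof -
  let ?N = "dimH l"
  have "(LINT a|\<mu>. (\<Phi> a * mat_adjoint (\<Psi> a)) $$ (i, j) * complex_of_real \<bar>D_star a\<bar>)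
      = (LINT a|\<mu>. (\<Sum>k<?N. \<Phi> a $$ (i, k) * cnj (\<Psi> a $$ (j, k)) * complex_of_real (D_star a)))"
  proof (rule Bochner_Integration.integral_cong[OF refl])
    fix a assume "a \<in> space \<mu>"
    then have c: "\<Phi> a \<in> carrier_mat ?N ?N" "\<Psi> a \<in> carrier_mat ?N ?N"
      using \<Phi> \<Psi> by (auto simp: L2_funs_iff)
    then have "mat_adjoint (\<Psi> a) \<in> carrier_mat ?N ?N" by auto
    from index_mult_mat_sum[OF c(1) this ij] c ij
    show "(\<Phi> a * mat_adjoint (\<Psi> a)) $$ (i, j) * complex_of_real \<bar>D_star a\<bar>
      = (\<Sum>k<?N. \<Phi> a $$ (i, k) * cnj (\<Psi> a $$ (j, k)) * complex_of_real (D_star a))"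
      by (simp add: mat_adjoint_index D_star_nonneg sum_distrib_right)
  qed
  also have "\<dots> = (\<Sum>k<?N. weighted_ip (\<lambda>a. \<Phi> a $$ (i, k)) (\<lambda>a. \<Psi> a $$ (j, k)))"
    unfolding weighted_ip_def
    using \<Phi> \<Psi> ij by (intro Bochner_Integration.integral_sum integrable_weighted_product) (auto simp: L2_funs_iff)
  finally show ?thesis using ij by (simp add: pairing_def)
qed

lemma pairing_carrier: "pairing \<mu> l \<Phi> \<Psi> \<in> carrier_mat (dimH l) (dimH l)"
  by (simp add: pairing_def)

lemma L2_funs_left_mult:
  assumes S: "S \<in> carrier_mat (dimH l) (dimH l)" and \<Phi>: "\<Phi> \<in> L2_funs \<mu> l"
  shows "(\<lambda>a. S * \<Phi> a) \<in> L2_funs \<mu> l"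
  unfolding L2_funs_iff
proof (intro conjI ballI allI impI)
  fix a assume "a \<in> A_star"
  then show "S * \<Phi> a \<in> carrier_mat (dimH l) (dimH l)"
    using S \<Phi> by (auto simp: L2_funs_iff)
next
  fix i j assume ij: "i < dimH l" "j < dimH l"
  have "square_integrable (\<lambda>a. (S * \<Phi> a) $$ (i, j))
      \<longleftrightarrow> square_integrable (\<lambda>a. \<Sum>k<dimH l. S $$ (i, k) * \<Phi> a $$ (k, j))"
    using \<Phi> ij by (intro square_integrable_cong index_mult_mat_sum[OF S]) (auto simp: L2_funs_iff)
  then show "square_integrable (\<lambda>a. (S * \<Phi> a) $$ (i, j))"
    using \<Phi> ij by (auto simp: L2_funs_iff intro!: square_integrable_sum square_integrable_cmult)
qed

lemma L2_funs_add:
  assumes "\<Phi> \<in> L2_funs \<mu> l" "\<Phi>' \<in> L2_funs \<mu> l"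
  shows "(\<lambda>a. \<Phi> a + \<Phi>' a) \<in> L2_funs \<mu> l"
  unfolding L2_funs_iff
proof (intro conjI ballI allI impI)
  fix i j assume ij: "i < dimH l" "j < dimH l"
  have "square_integrable (\<lambda>a. (\<Phi> a + \<Phi>' a) $$ (i, j))
      \<longleftrightarrow> square_integrable (\<lambda>a. \<Phi> a $$ (i, j) + \<Phi>' a $$ (i, j))"
    using assms ij by (intro square_integrable_cong index_add_mat) (auto simp: L2_funs_iff)
  then show "square_integrable (\<lambda>a. (\<Phi> a + \<Phi>' a) $$ (i, j))"
    using assms ij by (auto simp: L2_funs_iff intro!: square_integrable_add)
qed (use assms in \<open>auto simp: L2_funs_iff\<close>)

lemma L2_funs_smult:
  assumes "\<Phi> \<in> L2_funs \<mu> l"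
  shows "(\<lambda>a. c \<cdot>\<^sub>m \<Phi> a) \<in> L2_funs \<mu> l"
  unfolding L2_funs_iff
proof (intro conjI ballI allI impI)
  fix i j assume ij: "i < dimH l" "j < dimH l"
  have "square_integrable (\<lambda>a. (c \<cdot>\<^sub>m \<Phi> a) $$ (i, j)) \<longleftrightarrow> square_integrable (\<lambda>a. c * \<Phi> a $$ (i, j))"
    using assms ij by (intro square_integrable_cong index_smult_mat) (auto simp: L2_funs_iff)
  then show "square_integrable (\<lambda>a. (c \<cdot>\<^sub>m \<Phi> a) $$ (i, j))"
    using assms ij by (auto simp: L2_funs_iff intro!: square_integrable_cmult)
qed (use assms in \<open>auto simp: L2_funs_iff\<close>)

lemma pairing_add:
  assumes "\<Phi> \<in> L2_funs \<mu> l" "\<Phi>' \<in> L2_funs \<mu> l" "\<Psi> \<in> L2_funs \<mu> l"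
  shows "pairing \<mu> l (\<lambda>a. \<Phi> a + \<Phi>' a) \<Psi> = pairing \<mu> l \<Phi> \<Psi> + pairing \<mu> l \<Phi>' \<Psi>"
proof (rule eq_matI)
  fix i j
  assume "i < dim_row (pairing \<mu> l \<Phi> \<Psi> + pairing \<mu> l \<Phi>' \<Psi>)"
    "j < dim_col (pairing \<mu> l \<Phi> \<Psi> + pairing \<mu> l \<Phi>' \<Psi>)"
  then have ij: "i < dimH l" "j < dimH l" by (auto simp: pairing_def)
  have "weighted_ip (\<lambda>a. (\<Phi> a + \<Phi>' a) $$ (i, k)) (\<lambda>a. \<Psi> a $$ (j, k))
      = weighted_ip (\<lambda>a. \<Phi> a $$ (i, k)) (\<lambda>a. \<Psi> a $$ (j, k))
        + weighted_ip (\<lambda>a. \<Phi>' a $$ (i, k)) (\<lambda>a. \<Psi> a $$ (j, k))" if k: "k < dimH l" for k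
  proof -
    have "weighted_ip (\<lambda>a. (\<Phi> a + \<Phi>' a) $$ (i, k)) (\<lambda>a. \<Psi> a $$ (j, k))
      = weighted_ip (\<lambda>a. \<Phi> a $$ (i, k) + \<Phi>' a $$ (i, k)) (\<lambda>a. \<Psi> a $$ (j, k))"
      using assms ij k by (intro weighted_ip_cong index_add_mat refl) (auto simp: L2_funs_iff)
    also have "\<dots> = weighted_ip (\<lambda>a. \<Phi> a $$ (i, k)) (\<lambda>a. \<Psi> a $$ (j, k))
        + weighted_ip (\<lambda>a. \<Phi>' a $$ (i, k)) (\<lambda>a. \<Psi> a $$ (j, k))"
      using assms ij k by (intro weighted_ip_add) (auto simp: L2_funs_iff)
    finally show ?thesis .
  qed
  then show "pairing \<mu> l (\<lambda>a. \<Phi> a + \<Phi>' a) \<Psi> $$ (i, j) = (pairing \<mu> l \<Phi> \<Psi> + pairing \<mu> l \<Phi>' \<Psi>) $$ (i, j)"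
    using ij pairing_carrier[of l \<Phi>' \<Psi>]
    by (simp add: pairing_entry assms L2_funs_add sum.distrib distrib_left)
qed (auto simp: pairing_def)

lemma pairing_left_mult:
  assumes S: "S \<in> carrier_mat (dimH l) (dimH l)" and \<Phi>: "\<Phi> \<in> L2_funs \<mu> l" and \<Psi>: "\<Psi> \<in> L2_funs \<mu> l"
  shows "pairing \<mu> l (\<lambda>a. S * \<Phi> a) \<Psi> = S * pairing \<mu> l \<Phi> \<Psi>"
proof (rule eq_matI)
  fix i j assume "i < dim_row (S * pairing \<mu> l \<Phi> \<Psi>)" "j < dim_col (S * pairing \<mu> l \<Phi> \<Psi>)"
  then have ij: "i < dimH l" "j < dimH l" using S by (auto simp: pairing_def)
  let ?e = "\<lambda>k m. weighted_ip (\<lambda>a. \<Phi> a $$ (m, k)) (\<lambda>a. \<Psi> a $$ (j, k))"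
  have "weighted_ip (\<lambda>a. (S * \<Phi> a) $$ (i, k)) (\<lambda>a. \<Psi> a $$ (j, k)) = (\<Sum>m<dimH l. S $$ (i, m) * ?e k m)"
    if k: "k < dimH l" for k
  proof -
    have "weighted_ip (\<lambda>a. (S * \<Phi> a) $$ (i, k)) (\<lambda>a. \<Psi> a $$ (j, k))
      = weighted_ip (\<lambda>a. \<Sum>m<dimH l. S $$ (i, m) * \<Phi> a $$ (m, k)) (\<lambda>a. \<Psi> a $$ (j, k))"
      using \<Phi> ij k by (intro weighted_ip_cong index_mult_mat_sum[OF S] refl) (auto simp: L2_funs_iff)
    also have "\<dots> = (\<Sum>m<dimH l. weighted_ip (\<lambda>a. S $$ (i, m) * \<Phi> a $$ (m, k)) (\<lambda>a. \<Psi> a $$ (j, k)))"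
      using \<Phi> \<Psi> ij k by (intro weighted_ip_sum) (auto simp: L2_funs_iff intro!: square_integrable_cmult)
    finally show ?thesis by (simp add: weighted_ip_cmult)
  qed
  then have "pairing \<mu> l (\<lambda>a. S * \<Phi> a) \<Psi> $$ (i, j)
      = complex_of_real (2 / pi) * (\<Sum>k<dimH l. \<Sum>m<dimH l. S $$ (i, m) * ?e k m)"
    using ij by (simp add: pairing_entry L2_funs_left_mult S \<Phi> \<Psi>)
  also have "\<dots> = (\<Sum>m<dimH l. S $$ (i, m) * pairing \<mu> l \<Phi> \<Psi> $$ (m, j))"
    by (subst sum.swap) (simp add: pairing_entry[OF \<Phi> \<Psi> _ ij(2)] sum_distrib_left mult_ac)
  also have "\<dots> = (S * pairing \<mu> l \<Phi> \<Psi>) $$ (i, j)"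
    using index_mult_mat_sum[OF S pairing_carrier ij] by simp
  finally show "pairing \<mu> l (\<lambda>a. S * \<Phi> a) \<Psi> $$ (i, j) = (S * pairing \<mu> l \<Phi> \<Psi>) $$ (i, j)" .
qed (use S in \<open>auto simp: pairing_def\<close>)

lemma pairing_smult:
  assumes \<Phi>: "\<Phi> \<in> L2_funs \<mu> l" and \<Psi>: "\<Psi> \<in> L2_funs \<mu> l"
  shows "pairing \<mu> l (\<lambda>a. c \<cdot>\<^sub>m \<Phi> a) \<Psi> = c \<cdot>\<^sub>m pairing \<mu> l \<Phi> \<Psi>"
proof (rule eq_matI)
  fix i j assume "i < dim_row (c \<cdot>\<^sub>m pairing \<mu> l \<Phi> \<Psi>)" "j < dim_col (c \<cdot>\<^sub>m pairing \<mu> l \<Phi> \<Psi>)"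
  then have ij: "i < dimH l" "j < dimH l" by (auto simp: pairing_def)
  have "weighted_ip (\<lambda>a. (c \<cdot>\<^sub>m \<Phi> a) $$ (i, k)) (\<lambda>a. \<Psi> a $$ (j, k))
      = c * weighted_ip (\<lambda>a. \<Phi> a $$ (i, k)) (\<lambda>a. \<Psi> a $$ (j, k))" if k: "k < dimH l" for k
    unfolding weighted_ip_cmult[symmetric]
    using \<Phi> ij k by (intro weighted_ip_cong index_smult_mat refl) (auto simp: L2_funs_iff)
  then show "pairing \<mu> l (\<lambda>a. c \<cdot>\<^sub>m \<Phi> a) \<Psi> $$ (i, j) = (c \<cdot>\<^sub>m pairing \<mu> l \<Phi> \<Psi>) $$ (i, j)"
    using ij pairing_carrier[of l \<Phi> \<Psi>]
    by (simp add: pairing_entry \<Phi> \<Psi> L2_funs_smult sum_distrib_left mult_ac)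
qed (auto simp: pairing_def)

lemma pairing_adjoint:
  assumes \<Phi>: "\<Phi> \<in> L2_funs \<mu> l" and \<Psi>: "\<Psi> \<in> L2_funs \<mu> l"
  shows "mat_adjoint (pairing \<mu> l \<Phi> \<Psi>) = pairing \<mu> l \<Psi> \<Phi>"
proof (rule eq_matI)
  fix i j assume "i < dim_row (pairing \<mu> l \<Psi> \<Phi>)" "j < dim_col (pairing \<mu> l \<Psi> \<Phi>)"
  then have ij: "i < dimH l" "j < dimH l" by (auto simp: pairing_def)
  have "mat_adjoint (pairing \<mu> l \<Phi> \<Psi>) $$ (i, j) = cnj (pairing \<mu> l \<Phi> \<Psi> $$ (j, i))"
    using ij pairing_carrier[of l \<Phi> \<Psi>] by (intro mat_adjoint_index) auto
  then show "mat_adjoint (pairing \<mu> l \<Phi> \<Psi>) $$ (i, j) = pairing \<mu> l \<Psi> \<Phi> $$ (i, j)"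
    using ij by (simp add: pairing_entry \<Phi> \<Psi> weighted_ip_cnj)
qed (auto simp: pairing_def)

text \<open>
  On a vector \<open>v\<close> the form is \<open>2 / \<pi>\<close> times the sum over \<open>k\<close> of the squared norms of the entries \<open>F\<^sub>k\<close>
  of the row \<open>v\<^sup>* \<Phi>\<close>.
\<close>

lemma pairing_psd:
  assumes \<Phi>: "\<Phi> \<in> L2_funs \<mu> l"
  shows "psd_mat (dimH l) (pairing \<mu> l \<Phi> \<Phi>)"
  unfolding psd_mat_def
proof (intro conjI ballI pairing_carrier)
  let ?N = "dimH l" and ?M = "pairing \<mu> l \<Phi> \<Phi>"
  fix v :: "complex Matrix.vec" assume v: "v \<in> carrier_vec ?N"
  let ?v = "vec_index v"
  let ?F = "\<lambda>k a. \<Sum>i<?N. cnj (?v i) * \<Phi> a $$ (i, k)"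
  let ?e = "\<lambda>k i j. weighted_ip (\<lambda>a. \<Phi> a $$ (i, k)) (\<lambda>a. \<Phi> a $$ (j, k))"
  have e: "weighted_ip (?F k) (?F k) = (\<Sum>i<?N. \<Sum>j<?N. cnj (?v i) * ?v j * ?e k i j)" if k: "k < ?N" for k
  proof -
    have sq: "square_integrable (\<lambda>a. cnj (?v i) * \<Phi> a $$ (i, k))" if "i < ?N" for i
      using \<Phi> that k by (auto simp: L2_funs_iff intro: square_integrable_cmult)
    then have sqF: "square_integrable (?F k)" by (intro square_integrable_sum) auto
    have "weighted_ip (?F k) (?F k) = (\<Sum>i<?N. cnj (?v i) * weighted_ip (\<lambda>a. \<Phi> a $$ (i, k)) (?F k))"
      by (subst weighted_ip_sum) (use sq sqF in \<open>auto simp: weighted_ip_cmult\<close>)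
    also have "\<dots> = (\<Sum>i<?N. cnj (?v i) * (\<Sum>j<?N. ?v j * ?e k i j))"
      using \<Phi> k sq by (intro sum.cong refl arg_cong2[where f = "(*)"], subst weighted_ip_sum_right)
        (auto simp: L2_funs_iff weighted_ip_cmult_right)
    finally show ?thesis by (simp add: sum_distrib_left mult.assoc)
  qed
  have "(?M *\<^sub>v v) \<bullet>c v = (\<Sum>i<?N. (\<Sum>j<?N. ?M $$ (i, j) * ?v j) * cnj (?v i))"
    using v pairing_carrier[of l \<Phi> \<Phi>]
    by (auto simp: scalar_prod_def lessThan_atLeast0 intro!: sum.cong)
  also have "\<dots> = (\<Sum>i<?N. \<Sum>j<?N. \<Sum>k<?N. complex_of_real (2 / pi) * (cnj (?v i) * ?v j * ?e k i j))"
    by (intro sum.cong refl) (simp add: pairing_entry \<Phi> sum_distrib_left sum_distrib_right mult_ac)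
  also have "\<dots> = (\<Sum>i<?N. \<Sum>k<?N. \<Sum>j<?N. complex_of_real (2 / pi) * (cnj (?v i) * ?v j * ?e k i j))"
    by (intro sum.cong refl sum.swap)
  also have "\<dots> = (\<Sum>k<?N. \<Sum>i<?N. \<Sum>j<?N. complex_of_real (2 / pi) * (cnj (?v i) * ?v j * ?e k i j))"
    by (rule sum.swap)
  also have "\<dots> = (\<Sum>k<?N. complex_of_real (2 / pi) * weighted_ip (?F k) (?F k))"
    by (intro sum.cong refl) (simp add: e sum_distrib_left)
  also have "0 \<le> \<dots>"
    by (intro sum_nonneg mult_nonneg_nonneg weighted_ip_self_nonneg) (simp add: less_eq_complex_def)
  finally show "0 \<le> (?M *\<^sub>v v) \<bullet>c v" .
qed

lemma pairing_definite:
  assumes \<Phi>: "\<Phi> \<in> L2_funs \<mu> l" and 0: "pairing \<mu> l \<Phi> \<Phi> = 0\<^sub>m (dimH l) (dimH l)"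
  shows "AE a in \<mu>. \<Phi> a = 0\<^sub>m (dimH l) (dimH l)"
proof -
  have "AE a in \<mu>. \<Phi> a $$ (i, k) = 0" if i: "i < dimH l" and k: "k < dimH l" for i k
  proof (rule weighted_ip_definite)
    have "(\<Sum>k<dimH l. weighted_ip (\<lambda>a. \<Phi> a $$ (i, k)) (\<lambda>a. \<Phi> a $$ (i, k))) = 0"
      using pairing_entry[OF \<Phi> \<Phi> i i] i by (simp add: 0)
    then show "weighted_ip (\<lambda>a. \<Phi> a $$ (i, k)) (\<lambda>a. \<Phi> a $$ (i, k)) = 0"
      using k by (subst (asm) sum_nonneg_eq_0_iff) (auto intro: weighted_ip_self_nonneg)
  qed (use \<Phi> i k in \<open>auto simp: L2_funs_iff\<close>)
  then have "AE a in \<mu>. \<forall>i\<in>{..<dimH l}. \<forall>k\<in>{..<dimH l}. \<Phi> a $$ (i, k) = 0"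
    by (auto simp: AE_ball_countable)
  moreover have "AE a in \<mu>. a \<in> A_star" using AE_space[of \<mu>] by simp
  ultimately show ?thesis
  proof eventually_elim
    case (elim a)
    then have "\<Phi> a \<in> carrier_mat (dimH l) (dimH l)" using \<Phi> by (auto simp: L2_funs_iff)
    with elim show ?case by (intro eq_matI) auto
  qed
qed

text \<open>
  Continuous functions are square integrable, so both function spaces are instances; they differ in
  the closure properties and in what a vanishing norm implies.
\<close>

lemma matrix_inner_product_subspace:
  assumes V: "V \<subseteq> L2_funs \<mu> l"
    and add: "\<And>\<Phi> \<Phi>'. \<Phi> \<in> V \<Longrightarrow> \<Phi>' \<in> V \<Longrightarrow> (\<lambda>a. \<Phi> a + \<Phi>' a) \<in> V"
    and smult: "\<And>c \<Phi>. \<Phi> \<in> V \<Longrightarrow> (\<lambda>a. c \<cdot>\<^sub>m \<Phi> a) \<in> V"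
    and left: "\<And>S \<Phi>. S \<in> carrier_mat (dimH l) (dimH l) \<Longrightarrow> \<Phi> \<in> V \<Longrightarrow> (\<lambda>a. S * \<Phi> a) \<in> V"
    and null: "\<And>\<Phi>. \<Phi> \<in> V \<Longrightarrow> AE a in \<mu>. \<Phi> a = 0\<^sub>m (dimH l) (dimH l) \<Longrightarrow> null \<Phi>"
  shows "matrix_inner_product (dimH l) V null (pairing \<mu> l)"
  unfolding matrix_inner_product_def
  using V pairing_carrier[of l] add smult left null pairing_definite[of _ l]
  by (intro conjI ballI allI impI)
     (auto simp: subset_iff pairing_add pairing_smult pairing_left_mult pairing_adjoint pairing_psd)

theorem matrix_inner_product_L2:
  "matrix_inner_product (dimH l) (L2_funs \<mu> l)
     (\<lambda>\<Phi>. AE a in \<mu>. \<Phi> a = 0\<^sub>m (dimH l) (dimH l)) (pairing \<mu> l)"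
  by (rule matrix_inner_product_subspace)
     (auto intro: L2_funs_add L2_funs_smult L2_funs_left_mult)

theorem matrix_inner_product_continuous:
  "matrix_inner_product (dimH l) (cont_funs l)
     (\<lambda>\<Phi>. \<forall>a\<in>A_star. \<Phi> a = 0\<^sub>m (dimH l) (dimH l)) (pairing \<mu> l)"
proof (rule matrix_inner_product_subspace[OF cont_funs_subset_L2])
  let ?N = "dimH l"
  fix \<Phi> \<Phi>' assume \<Phi>: "\<Phi> \<in> cont_funs l" and \<Phi>': "\<Phi>' \<in> cont_funs l"
  have "continuous_on A_star (\<lambda>a. (\<Phi> a + \<Phi>' a) $$ (i, j))" if "i < ?N" "j < ?N" for i j
  proof -
    have "continuous_on A_star (\<lambda>a. \<Phi> a $$ (i, j) + \<Phi>' a $$ (i, j))"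
      using \<Phi> \<Phi>' that by (auto simp: cont_funs_def intro!: continuous_intros)
    then show ?thesis
      by (rule continuous_on_eq) (use \<Phi> \<Phi>' that in \<open>auto simp: cont_funs_def\<close>)
  qed
  then show "(\<lambda>a. \<Phi> a + \<Phi>' a) \<in> cont_funs l" using \<Phi> \<Phi>' by (auto simp: cont_funs_def)
next
  let ?N = "dimH l"
  fix c \<Phi> assume \<Phi>: "\<Phi> \<in> cont_funs l"
  have "continuous_on A_star (\<lambda>a. (c \<cdot>\<^sub>m \<Phi> a) $$ (i, j))" if "i < ?N" "j < ?N" for i j
  proof -
    have "continuous_on A_star (\<lambda>a. c * \<Phi> a $$ (i, j))"
      using \<Phi> that by (auto simp: cont_funs_def intro!: continuous_intros)
    then show ?thesis
      by (rule continuous_on_eq) (use \<Phi> that in \<open>auto simp: cont_funs_def\<close>)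
  qed
  then show "(\<lambda>a. c \<cdot>\<^sub>m \<Phi> a) \<in> cont_funs l" using \<Phi> by (auto simp: cont_funs_def)
next
  let ?N = "dimH l"
  fix S :: "complex mat" and \<Phi> assume S: "S \<in> carrier_mat ?N ?N" and \<Phi>: "\<Phi> \<in> cont_funs l"
  have "continuous_on A_star (\<lambda>a. (S * \<Phi> a) $$ (i, j))" if "i < ?N" "j < ?N" for i j
  proof -
    have "continuous_on A_star (\<lambda>a. \<Sum>k<?N. S $$ (i, k) * \<Phi> a $$ (k, j))"
      using \<Phi> that by (auto simp: cont_funs_def intro!: continuous_intros)
    then show ?thesis
      by (rule continuous_on_eq, subst index_mult_mat_sum[OF S])
         (use \<Phi> that in \<open>auto simp: cont_funs_def\<close>)
  qed
  then show "(\<lambda>a. S * \<Phi> a) \<in> cont_funs l" using S \<Phi> by (auto simp: cont_funs_def)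
next
  let ?N = "dimH l"
  fix \<Phi> assume \<Phi>: "\<Phi> \<in> cont_funs l" and ae: "AE a in \<mu>. \<Phi> a = 0\<^sub>m ?N ?N"
  show "\<forall>a\<in>A_star. \<Phi> a = 0\<^sub>m ?N ?N"
  proof
    fix a assume a: "a \<in> A_star"
    have "\<Phi> a $$ (i, j) = 0" if "i < ?N" "j < ?N" for i j
    proof (rule AE_zero_imp_zero[OF _ _ a])
      show "AE a in \<mu>. \<Phi> a $$ (i, j) = 0" using ae by eventually_elim (use that in simp)
    qed (use \<Phi> that in \<open>auto simp: cont_funs_def\<close>)
    moreover have "\<Phi> a \<in> carrier_mat ?N ?N" using \<Phi> a by (auto simp: cont_funs_def)
    ultimately show "\<Phi> a = 0\<^sub>m ?N ?N" by (intro eq_matI) auto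
  qed
qed

end

section \<open>Orthogonality\<close>

lemma Phi_full_circle_char:
  assumes a: "a \<in> A_star" and i: "i \<le> n" and q: "q \<le> n"
  shows "Phi_full (real n / 2) d a $$ (i, q)
    = (\<Sum>x\<in>{0..int (d + i)}. complex_of_real (phi_weight n d i q x) *
         circle_char (4 * x + 2 * (int q - int i - int d) - int n) a)"
proof -
  obtain t where t: "a = a_elt t" using a by (rule A_starE)
  have "(2 * of_int x - real i + real q - real d - real n / 2) * t
      = of_int (4 * x + 2 * (int q - int i - int d) - int n) * t / 2" for x :: int
    by (simp add: field_simps)
  then show ?thesis
    unfolding t Phi_full_entry[OF i q] circle_char_a_elt by presburger
qed

lemma Phi_full_cont_funs: "Phi_full (real n / 2) d \<in> cont_funs (real n / 2)"
proof -
  have "continuous_on A_star (\<lambda>a. Phi_full (real n / 2) d a $$ (i, q))" if "i \<le> n" "q \<le> n" for i q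
  proof (rule continuous_on_eq[OF _ Phi_full_circle_char[symmetric]])
    show "continuous_on A_star (\<lambda>a. \<Sum>x\<in>{0..int (d + i)}. complex_of_real (phi_weight n d i q x) *
         circle_char (4 * x + 2 * (int q - int i - int d) - int n) a)"
      by (intro continuous_intros continuous_on_circle_char)
  qed (use that in auto)
  then show ?thesis
    by (simp add: cont_funs_def dimH_half less_Suc_eq_le Phi_full_def)
qed

lemma phi_weight_outside: "x < 0 \<or> int (d + i) < x \<Longrightarrow> phi_weight n d i q x = 0"
  unfolding phi_weight_def by (subst cg_core_outside) auto

text \<open>
  For fixed \<open>q\<close> the sum runs over one weight of \<open>H\<^sup>\<ell>\<close>; summation over \<open>q\<close> as well exhausts all pairs
  \<open>(x, y)\<close> via \<open>y = x - i + q\<close>.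
\<close>

lemma phi_weight_overlap:
  assumes i: "i \<le> n" and i': "i' \<le> n" and f: "f = e + int i - int i'"
  shows "(\<Sum>q\<le>n. \<Sum>x\<in>{0..int (d + i)}. phi_weight n d i q x * phi_weight n d' i' q (x + e + s))
    = (cg_norm d i (n - i) * cg_norm d' i' (n - i'))\<^sup>2
      * overlap (cg_core d i (n - i)) (\<lambda>x y. cg_core d' i' (n - i') (x + e) (y + f)) s"
proof -
  let ?c = "cg_core d i (n - i)" and ?c' = "cg_core d' i' (n - i')"
  let ?S = "{(x, y). 0 \<le> x \<and> x \<le> int (d + i) \<and> 0 \<le> y - x + int i \<and> y - x + int i \<le> int n}"
  let ?g = "\<lambda>q x. (?c x (x - int i + int q))\<^sup>2 * (?c' (x + s + e) (x - int i + int q + s + f))\<^sup>2"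
  have out: "?c x y = 0" if "(x, y) \<notin> ?S" for x y
    by (rule cg_core_outside) (use that i in auto)
  have "overlap ?c (\<lambda>x y. ?c' (x + e) (y + f)) s
      = (\<Sum>\<^sub>\<infinity>(x, y)\<in>?S. (?c x y)\<^sup>2 * (?c' (x + s + e) (y + s + f))\<^sup>2)"
    unfolding overlap_def by (rule infsum_cong_neutral) (use out in force)+
  also have "\<dots> = (\<Sum>\<^sub>\<infinity>(q, x)\<in>{..n} \<times> {0..int (d + i)}. ?g q x)"
    by (rule infsum_reindex_bij_witness[of _ "\<lambda>(q, x). (x, x - int i + int q)" "\<lambda>(x, y). (nat (y - x + int i), x)"])
       auto
  also have "\<dots> = (\<Sum>q\<le>n. \<Sum>x\<in>{0..int (d + i)}. ?g q x)"
    by (simp add: sum.cartesian_product)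
  finally have o: "overlap ?c (\<lambda>x y. ?c' (x + e) (y + f)) s = (\<Sum>q\<le>n. \<Sum>x\<in>{0..int (d + i)}. ?g q x)" .
  have "phi_weight n d i q x * phi_weight n d' i' q (x + e + s)
      = (cg_norm d i (n - i) * cg_norm d' i' (n - i'))\<^sup>2 * ?g q x" for q x
  proof -
    have e: "x + e + s = x + s + e" "x + s + e - int i' + int q = x - int i + int q + s + f"
      using f by simp_all
    show ?thesis unfolding phi_weight_def e power_mult_distrib by (simp only: mult_ac)
  qed
  then show ?thesis
    unfolding o by (simp only: sum_distrib_left)
qed

context haar_circle
begin

lemma weighted_ip_circle_char:
  "weighted_ip (circle_char j) (circle_char k) = complex_of_real (measure \<mu> A_star / 4 *
     (2 * of_bool (k = j) - of_bool (k = j + 4) - of_bool (k = j - 4)))"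
proof -
  have "cnj (circle_char k a) = circle_char (- k) a" if "a \<in> A_star" for a
    using that by (auto elim!: A_starE simp: circle_char_a_elt cis_cnj)
  then have "weighted_ip (circle_char j) (circle_char k)
      = (LINT a|\<mu>. circle_char (j - k) a * complex_of_real (D_star a))"
    unfolding weighted_ip_def
    by (intro Bochner_Integration.integral_cong) (simp_all add: circle_char_mult)
  moreover have "j - k = 0 \<longleftrightarrow> k = j" "j - k = - 4 \<longleftrightarrow> k = j + 4" "j - k = 4 \<longleftrightarrow> k = j - 4" by auto
  ultimately show ?thesis by (simp only: integral_circle_char_weight) simp
qed

text \<open>
  Only the pairs of frequencies that differ by \<open>0\<close> or \<open>\<plusminus> 2\<close> (in \<open>t\<close>) survive the integration. The
  conditions are kept in doubled form, as \<open>(d' + i' - d - i) / 2\<close> need not be an integer.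
\<close>

lemma weighted_ip_Phi_full:
  assumes i: "i \<le> n" and i': "i' \<le> n" and q: "q \<le> n"
  shows "weighted_ip (\<lambda>a. Phi_full (real n / 2) d a $$ (i, q)) (\<lambda>a. Phi_full (real n / 2) d' a $$ (i', q))
    = complex_of_real (measure \<mu> A_star / 4 *
        (\<Sum>x\<in>{0..int (d + i)}. phi_weight n d i q x * (\<Sum>x'\<in>{0..int (d' + i')}. phi_weight n d' i' q x' *
          (2 * of_bool (2 * x' = 2 * x + (int (d' + i') - int (d + i)))
           - of_bool (2 * x' = 2 * x + (int (d' + i') - int (d + i)) + 2)
           - of_bool (2 * x' = 2 * x + (int (d' + i') - int (d + i)) - 2)))))"
proof -
  define k where "k = (\<lambda>d i x. 4 * x + 2 * (int q - int i - int d) - int n)"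
  have k: "k d' i' x' = k d i x \<longleftrightarrow> 2 * x' = 2 * x + (int (d' + i') - int (d + i))"
    "k d' i' x' = k d i x + 4 \<longleftrightarrow> 2 * x' = 2 * x + (int (d' + i') - int (d + i)) + 2"
    "k d' i' x' = k d i x - 4 \<longleftrightarrow> 2 * x' = 2 * x + (int (d' + i') - int (d + i)) - 2" for x x'
    unfolding k_def by auto
  let ?w = "\<lambda>d i x. complex_of_real (phi_weight n d i q x)"
  have sq: "square_integrable (\<lambda>a. c * circle_char j a)" for c j
    by (intro square_integrable_cmult square_integrable_continuous_on continuous_on_circle_char)
  have sqc: "square_integrable (circle_char j)" for j
    by (intro square_integrable_continuous_on continuous_on_circle_char)
  have "weighted_ip (\<lambda>a. Phi_full (real n / 2) d a $$ (i, q)) (\<lambda>a. Phi_full (real n / 2) d' a $$ (i', q))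
      = weighted_ip (\<lambda>a. \<Sum>x\<in>{0..int (d + i)}. ?w d i x * circle_char (k d i x) a)
          (\<lambda>a. \<Sum>x'\<in>{0..int (d' + i')}. ?w d' i' x' * circle_char (k d' i' x') a)"
    unfolding k_def using i i' q by (intro weighted_ip_cong Phi_full_circle_char)
  also have "\<dots> = (\<Sum>x\<in>{0..int (d + i)}. \<Sum>x'\<in>{0..int (d' + i')}.
      ?w d i x * ?w d' i' x' * weighted_ip (circle_char (k d i x)) (circle_char (k d' i' x')))"
    by (simp add: weighted_ip_sum weighted_ip_sum_right sq sqc square_integrable_sum weighted_ip_cmult
        weighted_ip_cmult_right sum_distrib_left mult.assoc)
  also have "\<dots> = complex_of_real (\<Sum>x\<in>{0..int (d + i)}. \<Sum>x'\<in>{0..int (d' + i')}.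
      phi_weight n d i q x * phi_weight n d' i' q x' * (measure \<mu> A_star / 4 *
     (2 * of_bool (k d' i' x' = k d i x) - of_bool (k d' i' x' = k d i x + 4)
        - of_bool (k d' i' x' = k d i x - 4))))"
    by (simp only: weighted_ip_circle_char of_real_sum of_real_mult)
  finally show ?thesis unfolding k by (simp add: sum_distrib_left mult_ac)
qed

text \<open>
  If \<open>d' + i' - d - i\<close> is odd then no frequency survives. Otherwise half of it is the shift \<open>e\<close>, and
  the sum over \<open>q\<close> is a multiple of \<open>2 |B\<^sub>0|\<^sup>2 - |B\<^sub>1|\<^sup>2 - |B\<^sub>-\<^sub>1|\<^sup>2\<close>.
\<close>

lemma sum_weighted_ip_Phi_full:
  assumes i: "i \<le> n" and i': "i' \<le> n" and d: "d \<noteq> d'"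
  shows "(\<Sum>q\<le>n. weighted_ip (\<lambda>a. Phi_full (real n / 2) d a $$ (i, q))
            (\<lambda>a. Phi_full (real n / 2) d' a $$ (i', q))) = 0"
proof (cases "even (int (d' + i') - int (d + i))")
  case False
  then have nz: "(2 * x' = 2 * x + (int (d' + i') - int (d + i))) = False"
    "(2 * x' = 2 * x + (int (d' + i') - int (d + i)) + 2) = False"
    "(2 * x' = 2 * x + (int (d' + i') - int (d + i)) - 2) = False" for x x' :: int
    by presburger+
  have "weighted_ip (\<lambda>a. Phi_full (real n / 2) d a $$ (i, q))
            (\<lambda>a. Phi_full (real n / 2) d' a $$ (i', q)) = 0" if "q \<le> n" for q
    unfolding weighted_ip_Phi_full[OF i i' that] by (simp only: nz of_bool_eq) simp
  then show ?thesis by (intro sum.neutral) auto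
next
  case True
  then obtain e where e: "int (d' + i') - int (d + i) = 2 * e" by blast
  let ?w = "phi_weight n d i" and ?w' = "phi_weight n d' i'"
  define T where "T s = (\<Sum>q\<le>n. \<Sum>x\<in>{0..int (d + i)}. ?w q x * ?w' q (x + e + s))" for s
  have pick: "(\<Sum>x'\<in>{0..int (d' + i')}. ?w' q x' * of_bool (x' = z)) = ?w' q z" for q z
  proof (cases "z \<in> {0..int (d' + i')}")
    case False
    then show ?thesis using phi_weight_outside[of z d' i' n q] by (auto simp: of_bool_def intro!: sum.neutral)
  qed (simp add: of_bool_def if_distrib[of "\<lambda>b. _ * b"] cong: if_cong)
  have inner: "(\<Sum>x'\<in>{0..int (d' + i')}. ?w' q x' *
          (2 * of_bool (2 * x' = 2 * x + 2 * e) - of_bool (2 * x' = 2 * x + 2 * e + 2)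
           - of_bool (2 * x' = 2 * x + 2 * e - 2)))
      = 2 * ?w' q (x + e + 0) - ?w' q (x + e + 1) - ?w' q (x + e + - 1)" for q x
  proof -
    have "2 * x' = 2 * x + 2 * e \<longleftrightarrow> x' = x + e + 0" "2 * x' = 2 * x + 2 * e + 2 \<longleftrightarrow> x' = x + e + 1"
      "2 * x' = 2 * x + 2 * e - 2 \<longleftrightarrow> x' = x + e + - 1" for x' by linarith+
    then have "(\<Sum>x'\<in>{0..int (d' + i')}. ?w' q x' *
          (2 * of_bool (2 * x' = 2 * x + 2 * e) - of_bool (2 * x' = 2 * x + 2 * e + 2)
           - of_bool (2 * x' = 2 * x + 2 * e - 2)))
      = (\<Sum>x'\<in>{0..int (d' + i')}. 2 * (?w' q x' * of_bool (x' = x + e + 0))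
          - ?w' q x' * of_bool (x' = x + e + 1) - ?w' q x' * of_bool (x' = x + e + - 1))"
      by (intro sum.cong refl) (simp only: right_diff_distrib mult.left_commute)
    then show ?thesis by (simp only: sum_subtractf sum_distrib_left[symmetric] pick)
  qed
  have "(\<Sum>q\<le>n. weighted_ip (\<lambda>a. Phi_full (real n / 2) d a $$ (i, q))
            (\<lambda>a. Phi_full (real n / 2) d' a $$ (i', q)))
      = complex_of_real (\<Sum>q\<le>n. measure \<mu> A_star / 4 * (\<Sum>x\<in>{0..int (d + i)}. ?w q x *
          (2 * ?w' q (x + e + 0) - ?w' q (x + e + 1) - ?w' q (x + e + - 1))))"
    unfolding of_real_sum
    by (intro sum.cong refl, subst weighted_ip_Phi_full[OF i i']) (simp_all only: atMost_iff e inner)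
  also have "(\<Sum>q\<le>n. measure \<mu> A_star / 4 * (\<Sum>x\<in>{0..int (d + i)}. ?w q x *
          (2 * ?w' q (x + e + 0) - ?w' q (x + e + 1) - ?w' q (x + e + - 1))))
      = measure \<mu> A_star / 4 * (2 * T 0 - T 1 - T (- 1))"
    unfolding T_def
    by (simp only: sum_distrib_left[symmetric] right_diff_distrib sum_subtractf mult.left_commute[of _ 2])
  also have "2 * T 0 - T 1 - T (- 1) = 0"
  proof -
    define f where "f = e + int i - int i'"
    let ?o = "overlap (cg_core d i (n - i)) (\<lambda>x y. cg_core d' i' (n - i') (x + e) (y + f))"
    \<comment> \<open>The squares of the norms factor out, so the identity for \<open>cg_core\<close> suffices.\<close>
    have T: "T s = (cg_norm d i (n - i) * cg_norm d' i' (n - i'))\<^sup>2 * ?o s" for s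
      unfolding T_def by (rule phi_weight_overlap[OF i i' f_def])
    have "2 * ?o 0 = ?o 1 + ?o (- 1)"
    proof (rule cg_core_overlap[OF _ _ _ d])
      show "i + (n - i) = i' + (n - i')" using i i' by simp
      show "int (d' + i') = int (d + i) + 2 * e" using e by simp
      then show "int (d' + (n - i')) = int (d + (n - i)) + 2 * f"
        using i i' by (simp add: f_def of_nat_diff)
    qed
    then have "?o 1 = 2 * ?o 0 - ?o (- 1)" by simp
    then show ?thesis unfolding T by (simp only:) (simp add: algebra_simps)
  qed
  finally show ?thesis by simp
qed

theorem Phi_full_orthogonal:
  assumes "d \<noteq> d'"
  shows "pairing \<mu> (real n / 2) (Phi_full (real n / 2) d) (Phi_full (real n / 2) d')
    = 0\<^sub>m (dimH (real n / 2)) (dimH (real n / 2))"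
proof (rule eq_matI)
  let ?l = "real n / 2"
  fix i j assume "i < dim_row (0\<^sub>m (dimH ?l) (dimH ?l) :: complex mat)"
    "j < dim_col (0\<^sub>m (dimH ?l) (dimH ?l) :: complex mat)"
  then have ij: "i < dimH ?l" "j < dimH ?l" by auto
  have L2: "Phi_full ?l d \<in> L2_funs \<mu> ?l" for d
    using Phi_full_cont_funs cont_funs_subset_L2 by blast
  show "pairing \<mu> ?l (Phi_full ?l d) (Phi_full ?l d') $$ (i, j) = 0\<^sub>m (dimH ?l) (dimH ?l) $$ (i, j)"
    using ij sum_weighted_ip_Phi_full[of i n j d d'] assms
    unfolding pairing_entry[OF L2 L2 ij]
    by (simp add: dimH_half lessThan_Suc_atMost less_Suc_eq_le del: sum.lessThan_Suc sum.atMost_Suc)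
qed (auto simp: pairing_def)

end

theorem proposition4p6:
  fixes l :: real and \<mu> :: "(cmat2 \<times> cmat2) measure"
  assumes "l \<in> half_nats"
    and "haar_measure_A_star \<mu>"
  shows "matrix_inner_product (dimH l) (cont_funs l)
           (\<lambda>\<Phi>. \<forall>a\<in>A_star. \<Phi> a = 0\<^sub>m (dimH l) (dimH l)) (pairing \<mu> l)
       \<and> matrix_inner_product (dimH l) (L2_funs \<mu> l)
           (\<lambda>\<Phi>. AE a in \<mu>. \<Phi> a = 0\<^sub>m (dimH l) (dimH l)) (pairing \<mu> l)
       \<and> orthogonal_family (dimH l) (cont_funs l) (pairing \<mu> l) (Phi_full l)"
proof -
  interpret haar_circle \<mu> by standard (rule assms(2))
  obtain n where l: "l = real n / 2" using assms(1) by (auto simp: half_nats_def)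
  have "orthogonal_family (dimH l) (cont_funs l) (pairing \<mu> l) (Phi_full l)"
    unfolding orthogonal_family_def l by (auto intro: Phi_full_cont_funs Phi_full_orthogonal)
  then show ?thesis
    using matrix_inner_product_continuous matrix_inner_product_L2 by blast
qed

end
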